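(* Let $K$ be a finite field of positive characteristic $p$. Let $G\cong H\times X$ be a finite abelian group, where $H$ is a $p$-regular group (no element of $H$ has order divisible by $p$) and $X$ is a $p$-group with presentation $$X=\langle x_1,\ldots,x_n \mid x_k^{p^{m_k}}=1,\ [x_k,x_l]=1 \text{ for all } k,l\in\{1,\ldots,n\}\rangle,$$ where $n,m_k\in\mathbb{N}$. Let $\alpha:G\times G\to K^*$ be a normalized $2$-cocycle such that $H\subset Z_\alpha(G)$. For $i,j\in\{1,\ldots,n\}$ define the map $f_i:\{x_1,\ldots,x_n\}\to K^\alpha G$ by $f_i(x_j)=1$ if $i=j$ and $f_i(x_j)=0$ otherwise. Then each $f_i$ can be uniquely extended to a derivation of $K^\alpha G$, denoted $\partial_i$ (that is, there is a unique derivation $\partial_i$ of $K^\alpha G$ with $\partial_i(\overline{x_j})=f_i(x_j)$ for all $j$). Moreover, $\mathrm{Der}(K^\alpha G)$ is a vector space over $K$ with basis $$\{\overline{g}\,\partial_i \mid g\in G,\ i=1,\ldots,n\}.$$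
   Context: A $2$-cocycle is a map $\alpha:G\times G\to K^*$ with $\alpha(x,y)\alpha(xy,z)=\alpha(y,z)\alpha(x,yz)$ for all $x,y,z\in G$; it is normalized if $\alpha(1,g)=\alpha(g,1)=1$ for all $g\in G$. The twisted group ring $K^\alpha G$ is the $K$-vector space with basis $\{\overline{g}:g\in G\}$ and product $(a\overline{g})(b\overline{h})=ab\,\alpha(g,h)\,\overline{gh}$, extended by linearity; its identity is $1=\overline{1}$. $Z_\alpha(G)=\{a\in Z(G):\alpha(a,x)=\alpha(x,a)\ \text{for all }x\in G\}$. A derivation of a ring $S$ is an additive map $d:S\to S$ with $d(ab)=d(a)b+a\,d(b)$ for all $a,b\in S$; $\mathrm{Der}(S)$ is the set of derivations of $S$. The map $\overline{g}\,\partial_i$ is $x\mapsto \overline{g}\cdot\partial_i(x)$. *)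

theory Defs
  imports "HOL-Algebra.Multiplicative_Group" "Jordan_Normal_Form.Missing_VectorSpace"
begin

section \<open>Groups\<close>

definition p_regular :: "nat \<Rightarrow> ('g, 'r) monoid_scheme \<Rightarrow> bool" where
  "p_regular p G \<longleftrightarrow> (\<forall>g\<in>carrier G. \<not> p dvd group.ord G g)"

definition p_group :: "nat \<Rightarrow> ('g, 'r) monoid_scheme \<Rightarrow> bool" where
  "p_group p G \<longleftrightarrow> (\<forall>g\<in>carrier G. \<exists>k. group.ord G g = p ^ k)"

text \<open>The letter \<open>(k, True)\<close> of a group word stands for the generator \<open>x k\<close> and
  \<open>(k, False)\<close> for its inverse.\<close>

type_synonym 'i group_word = "('i \<times> bool) list"

fun eval_word :: "('g, 'r) monoid_scheme \<Rightarrow> ('i \<Rightarrow> 'g) \<Rightarrow> 'i group_word \<Rightarrow> 'g" where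
  "eval_word G x [] = \<one>\<^bsub>G\<^esub>"
| "eval_word G x ((k, b) # w) = (if b then x k else inv\<^bsub>G\<^esub> (x k)) \<otimes>\<^bsub>G\<^esub> eval_word G x w"

text \<open>The congruence on words over \<open>I\<close> whose classes are the elements of the group
  \<open>\<langle>I | R\<rangle>\<close>: it is generated by free cancellation and by deletion of relators.\<close>

inductive word_equiv :: "'i set \<Rightarrow> 'i group_word set \<Rightarrow> 'i group_word \<Rightarrow> 'i group_word \<Rightarrow> bool"
  for I :: "'i set" and R :: "'i group_word set" where
  word_refl: "word_equiv I R w w"
| word_sym: "word_equiv I R u v \<Longrightarrow> word_equiv I R v u"
| word_trans: "word_equiv I R u v \<Longrightarrow> word_equiv I R v w \<Longrightarrow> word_equiv I R u w"
| word_cancel: "k \<in> I \<Longrightarrow> word_equiv I R (u @ [(k, b), (k, \<not> b)] @ v) (u @ v)"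
| word_relator: "r \<in> R \<Longrightarrow> word_equiv I R (u @ r @ v) (u @ v)"

text \<open>\<open>Q = \<langle>x k (k \<in> I) | R\<rangle>\<close>: evaluation of words induces a bijection from the
  group of classes of words onto \<open>Q\<close>.\<close>

definition has_presentation ::
    "('g, 'r) monoid_scheme \<Rightarrow> 'i set \<Rightarrow> ('i \<Rightarrow> 'g) \<Rightarrow> 'i group_word set \<Rightarrow> bool" where
  "has_presentation Q I x R \<longleftrightarrow>
     group Q \<and> x \<in> I \<rightarrow> carrier Q \<and> R \<subseteq> lists (I \<times> UNIV) \<and>
     (\<forall>g\<in>carrier Q. \<exists>w\<in>lists (I \<times> UNIV). eval_word Q x w = g) \<and>
     (\<forall>u\<in>lists (I \<times> UNIV). \<forall>v\<in>lists (I \<times> UNIV).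
        eval_word Q x u = eval_word Q x v \<longleftrightarrow> word_equiv I R u v)"

definition power_relator :: "'i \<Rightarrow> nat \<Rightarrow> 'i group_word" where
  "power_relator k e = replicate e (k, True)"

definition commutator_relator :: "'i \<Rightarrow> 'i \<Rightarrow> 'i group_word" where
  "commutator_relator k l = [(k, False), (l, False), (k, True), (l, True)]"

definition group_center :: "('g, 'r) monoid_scheme \<Rightarrow> 'g set" where
  "group_center G = {a \<in> carrier G. \<forall>x\<in>carrier G. a \<otimes>\<^bsub>G\<^esub> x = x \<otimes>\<^bsub>G\<^esub> a}"


section \<open>Twisted group rings\<close>

definition ring_characteristic :: "('k, 'r) ring_scheme \<Rightarrow> nat" where
  "ring_characteristic K = group.ord (add_monoid K) \<one>\<^bsub>K\<^esub>"

definition two_cocycle ::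
    "('k, 'r) ring_scheme \<Rightarrow> ('g, 's) monoid_scheme \<Rightarrow> ('g \<Rightarrow> 'g \<Rightarrow> 'k) \<Rightarrow> bool" where
  "two_cocycle K G \<alpha> \<longleftrightarrow>
     \<alpha> \<in> carrier G \<rightarrow> carrier G \<rightarrow> Units K \<and>
     (\<forall>x\<in>carrier G. \<forall>y\<in>carrier G. \<forall>z\<in>carrier G.
        \<alpha> x y \<otimes>\<^bsub>K\<^esub> \<alpha> (x \<otimes>\<^bsub>G\<^esub> y) z = \<alpha> y z \<otimes>\<^bsub>K\<^esub> \<alpha> x (y \<otimes>\<^bsub>G\<^esub> z))"

definition normalized_cocycle ::
    "('k, 'r) ring_scheme \<Rightarrow> ('g, 's) monoid_scheme \<Rightarrow> ('g \<Rightarrow> 'g \<Rightarrow> 'k) \<Rightarrow> bool" where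
  "normalized_cocycle K G \<alpha> \<longleftrightarrow>
     (\<forall>g\<in>carrier G. \<alpha> \<one>\<^bsub>G\<^esub> g = \<one>\<^bsub>K\<^esub> \<and> \<alpha> g \<one>\<^bsub>G\<^esub> = \<one>\<^bsub>K\<^esub>)"

definition alpha_center :: "('g, 's) monoid_scheme \<Rightarrow> ('g \<Rightarrow> 'g \<Rightarrow> 'k) \<Rightarrow> 'g set" where
  "alpha_center G \<alpha> = {a \<in> group_center G. \<forall>x\<in>carrier G. \<alpha> a x = \<alpha> x a}"

definition basis_elem ::
    "('k, 'r) ring_scheme \<Rightarrow> ('g, 's) monoid_scheme \<Rightarrow> 'g \<Rightarrow> 'g \<Rightarrow> 'k" where
  "basis_elem K G g = (\<lambda>h\<in>carrier G. if h = g then \<one>\<^bsub>K\<^esub> else \<zero>\<^bsub>K\<^esub>)"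

text \<open>For finite \<open>G\<close>: the function \<open>a\<close> represents the sum of all \<open>a g\<close> times
  \<open>basis_elem K G g\<close>.\<close>

definition twisted_group_ring ::
    "('k, 'r) ring_scheme \<Rightarrow> ('g, 's) monoid_scheme \<Rightarrow> ('g \<Rightarrow> 'g \<Rightarrow> 'k) \<Rightarrow> ('k, 'g \<Rightarrow> 'k) module" where
  "twisted_group_ring K G \<alpha> =
     \<lparr>carrier = carrier G \<rightarrow>\<^sub>E carrier K,
      mult = (\<lambda>a b. \<lambda>z\<in>carrier G.
        finsum K (\<lambda>(x, y). a x \<otimes>\<^bsub>K\<^esub> b y \<otimes>\<^bsub>K\<^esub> \<alpha> x y)
          {(x, y). x \<in> carrier G \<and> y \<in> carrier G \<and> x \<otimes>\<^bsub>G\<^esub> y = z}),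
      one = basis_elem K G \<one>\<^bsub>G\<^esub>,
      zero = (\<lambda>g\<in>carrier G. \<zero>\<^bsub>K\<^esub>),
      add = (\<lambda>a b. \<lambda>g\<in>carrier G. a g \<oplus>\<^bsub>K\<^esub> b g),
      smult = (\<lambda>c a. \<lambda>g\<in>carrier G. c \<otimes>\<^bsub>K\<^esub> a g)\<rparr>"

lemma twisted_group_ring_basis_mult:
  assumes "cring K" "group G" "two_cocycle K G \<alpha>" "finite (carrier G)"
    and gh: "g \<in> carrier G" "h \<in> carrier G"
  shows "basis_elem K G g \<otimes>\<^bsub>twisted_group_ring K G \<alpha>\<^esub> basis_elem K G h =
         \<alpha> g h \<odot>\<^bsub>twisted_group_ring K G \<alpha>\<^esub> basis_elem K G (g \<otimes>\<^bsub>G\<^esub> h)"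
proof -
  interpret K: cring K by fact
  interpret G: group G by fact
  have \<alpha>: "\<alpha> x y \<in> carrier K" if "x \<in> carrier G" "y \<in> carrier G" for x y
    using assms(3) that unfolding two_cocycle_def Units_def by (auto simp: Pi_def)
  show ?thesis
  proof (rule ext)
    fix z
    show "(basis_elem K G g \<otimes>\<^bsub>twisted_group_ring K G \<alpha>\<^esub> basis_elem K G h) z =
      (\<alpha> g h \<odot>\<^bsub>twisted_group_ring K G \<alpha>\<^esub> basis_elem K G (g \<otimes>\<^bsub>G\<^esub> h)) z"
    proof (cases "z \<in> carrier G")
      case True
      let ?A = "{(x, y). x \<in> carrier G \<and> y \<in> carrier G \<and> x \<otimes>\<^bsub>G\<^esub> y = z}"
      have fin: "finite ?A"
        by (rule finite_subset[of _ "carrier G \<times> carrier G"]) (use assms(4) in auto)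
      have "finsum K (\<lambda>(x, y). basis_elem K G g x \<otimes>\<^bsub>K\<^esub> basis_elem K G h y \<otimes>\<^bsub>K\<^esub> \<alpha> x y) ?A
        = (\<Oplus>\<^bsub>K\<^esub>q \<in> ?A. if (g, h) = q then \<alpha> g h else \<zero>\<^bsub>K\<^esub>)"
        by (rule K.finsum_cong') (use \<alpha> gh in \<open>auto simp: basis_elem_def split: if_splits\<close>)
      also have "\<dots> = (if g \<otimes>\<^bsub>G\<^esub> h = z then \<alpha> g h else \<zero>\<^bsub>K\<^esub>)"
      proof (cases "g \<otimes>\<^bsub>G\<^esub> h = z")
        case True
        then show ?thesis
          using K.finsum_singleton[of "(g, h)" ?A "\<lambda>_. \<alpha> g h"] fin \<alpha> gh by simp
      next
        case False
        then have "(\<Oplus>\<^bsub>K\<^esub>q \<in> ?A. if (g, h) = q then \<alpha> g h else \<zero>\<^bsub>K\<^esub>) = (\<Oplus>\<^bsub>K\<^esub>q \<in> ?A. \<zero>\<^bsub>K\<^esub>)"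
          by (intro K.finsum_cong') auto
        with False show ?thesis by simp
      qed
      finally show ?thesis
        using True \<alpha> gh by (auto simp: twisted_group_ring_def basis_elem_def)
    qed (simp add: twisted_group_ring_def)
  qed
qed


section \<open>Derivations\<close>

definition derivations :: "('a, 'r) ring_scheme \<Rightarrow> ('a \<Rightarrow> 'a) set" where
  "derivations S = {d \<in> carrier S \<rightarrow>\<^sub>E carrier S.
     (\<forall>a\<in>carrier S. \<forall>b\<in>carrier S.
        d (a \<oplus>\<^bsub>S\<^esub> b) = d a \<oplus>\<^bsub>S\<^esub> d b \<and>
        d (a \<otimes>\<^bsub>S\<^esub> b) = d a \<otimes>\<^bsub>S\<^esub> b \<oplus>\<^bsub>S\<^esub> a \<otimes>\<^bsub>S\<^esub> d b)}"

text \<open>\<open>Der(S)\<close> with the pointwise operations; the multiplicative fields of the record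
  play no role in its additive and scalar structure.\<close>

definition derivation_module :: "('k, 'a, 'r) module_scheme \<Rightarrow> ('k, 'a \<Rightarrow> 'a) module" where
  "derivation_module S =
     \<lparr>carrier = derivations S,
      mult = undefined,
      one = undefined,
      zero = (\<lambda>a\<in>carrier S. \<zero>\<^bsub>S\<^esub>),
      add = (\<lambda>d e. \<lambda>a\<in>carrier S. d a \<oplus>\<^bsub>S\<^esub> e a),
      smult = (\<lambda>c d. \<lambda>a\<in>carrier S. c \<odot>\<^bsub>S\<^esub> d a)\<rparr>"

definition left_mult :: "('a, 'r) ring_scheme \<Rightarrow> 'a \<Rightarrow> ('a \<Rightarrow> 'a) \<Rightarrow> 'a \<Rightarrow> 'a" where
  "left_mult S s d = (\<lambda>a\<in>carrier S. s \<otimes>\<^bsub>S\<^esub> d a)"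

definition extends_coordinate ::
    "('k, 'r) ring_scheme \<Rightarrow> ('g, 's) monoid_scheme \<Rightarrow> ('g \<Rightarrow> 'g \<Rightarrow> 'k) \<Rightarrow> nat \<Rightarrow> (nat \<Rightarrow> 'g) \<Rightarrow> nat \<Rightarrow>
     (('g \<Rightarrow> 'k) \<Rightarrow> ('g \<Rightarrow> 'k)) \<Rightarrow> bool" where
  "extends_coordinate K G \<alpha> n x i d \<longleftrightarrow>
     (\<forall>j\<in>{1..n}. d (basis_elem K G (x j)) =
        (if i = j then \<one>\<^bsub>twisted_group_ring K G \<alpha>\<^esub> else \<zero>\<^bsub>twisted_group_ring K G \<alpha>\<^esub>))"

definition partial_derivation ::
    "('k, 'r) ring_scheme \<Rightarrow> ('g, 's) monoid_scheme \<Rightarrow> ('g \<Rightarrow> 'g \<Rightarrow> 'k) \<Rightarrow> nat \<Rightarrow> (nat \<Rightarrow> 'g) \<Rightarrow> nat \<Rightarrow>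
     ('g \<Rightarrow> 'k) \<Rightarrow> ('g \<Rightarrow> 'k)" where
  "partial_derivation K G \<alpha> n x i =
     (THE d. d \<in> derivations (twisted_group_ring K G \<alpha>) \<and> extends_coordinate K G \<alpha> n x i d)"

end

theory Submission
  imports Defs
begin

text \<open>
  Write \<open>A\<close> for the twisted group ring and \<open>B g\<close> for its basis elements.

  The ring \<open>A\<close> is commutative. The pairing \<open>\<alpha> g h / \<alpha> h g\<close> is multiplicative in \<open>h\<close>; it is
  trivial for \<open>h \<in> H\<close> by hypothesis, and for \<open>h \<in> X\<close> its value is killed both by a power of \<open>p\<close>
  and by \<open>card K - 1\<close>, which are coprime (\<open>cocycle_symmetric_p_element\<close>).

  Existence: the assignment \<open>x\<^sub>i \<mapsto> 1\<close>, \<open>x\<^sub>j \<mapsto> 0\<close> for \<open>j \<noteq> i\<close> respects the relators of \<open>X\<close> because \<open>p ^ m k = 0\<close> in \<open>K\<close>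
  and \<open>(K, +)\<close> is abelian, so it extends to a homomorphism \<open>\<theta>\<^sub>i\<close> from \<open>G\<close> to \<open>(K, +)\<close> that is
  trivial on \<open>H\<close>. Multiplying the coefficient of each \<open>B g\<close> by \<open>\<theta>\<^sub>i g\<close> is a derivation, the
  analogue of the Euler operator \<open>x\<^sub>i \<partial>/\<partial>x\<^sub>i\<close>, and dividing it by the unit \<open>B x\<^sub>i\<close> gives
  \<open>\<partial>\<^sub>i\<close> (written \<open>\<delta> i\<close> below; \<open>scaled_euler_derivation\<close>).

  Uniqueness: in a finite field \<open>c = c ^ card K\<close>, and \<open>card K\<close> is a multiple of \<open>p\<close>, so every
  derivation kills the scalars and is \<open>K\<close>-linear. It kills \<open>B h\<close> for \<open>h\<close> of order \<open>r\<close> prime to \<open>p\<close>,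
  because \<open>(B h) ^ r\<close> is a scalar. The elements \<open>g\<close> with \<open>B g\<close> in its kernel form a subgroup, which
  is all of \<open>G\<close> once it contains \<open>H\<close> and all \<open>x\<^sub>j\<close>. So a derivation is determined by its
  values on the \<open>B x\<^sub>j\<close> (\<open>derivation_determined\<close>).

  Basis: the functionals taking \<open>d\<close> to the coefficient of \<open>B g\<close> in \<open>d (B x\<^sub>i)\<close> are dual to the
  derivations \<open>B g \<cdot> \<partial>\<^sub>i\<close>, and by uniqueness they vanish together only at \<open>d = 0\<close>; a family with such
  a dual family is a basis (\<open>dual_family_basis\<close>).
\<close>

section \<open>Derivations of a commutative algebra\<close>

lemma derivationsI:
  assumes "d \<in> carrier S \<rightarrow>\<^sub>E carrier S"
    and "\<And>a b. a \<in> carrier S \<Longrightarrow> b \<in> carrier S \<Longrightarrow> d (a \<oplus>\<^bsub>S\<^esub> b) = d a \<oplus>\<^bsub>S\<^esub> d b"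
    and "\<And>a b. a \<in> carrier S \<Longrightarrow> b \<in> carrier S \<Longrightarrow>
           d (a \<otimes>\<^bsub>S\<^esub> b) = d a \<otimes>\<^bsub>S\<^esub> b \<oplus>\<^bsub>S\<^esub> a \<otimes>\<^bsub>S\<^esub> d b"
  shows "d \<in> derivations S"
  using assms unfolding derivations_def by blast

lemma derivation_closed: "d \<in> derivations S \<Longrightarrow> a \<in> carrier S \<Longrightarrow> d a \<in> carrier S"
  unfolding derivations_def by blast

lemma derivation_add:
  "d \<in> derivations S \<Longrightarrow> a \<in> carrier S \<Longrightarrow> b \<in> carrier S \<Longrightarrow> d (a \<oplus>\<^bsub>S\<^esub> b) = d a \<oplus>\<^bsub>S\<^esub> d b"
  unfolding derivations_def by blast

lemma derivation_mult:
  "d \<in> derivations S \<Longrightarrow> a \<in> carrier S \<Longrightarrow> b \<in> carrier S \<Longrightarrow>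
     d (a \<otimes>\<^bsub>S\<^esub> b) = d a \<otimes>\<^bsub>S\<^esub> b \<oplus>\<^bsub>S\<^esub> a \<otimes>\<^bsub>S\<^esub> d b"
  unfolding derivations_def by blast

lemma derivation_eqI:
  assumes "d \<in> derivations S" "e \<in> derivations S" "\<And>a. a \<in> carrier S \<Longrightarrow> d a = e a"
  shows "d = e"
  using assms unfolding derivations_def by (auto intro: PiE_ext)

context ring
begin

lemma derivation_zero:
  assumes d: "d \<in> derivations R"
  shows "d \<zero> = \<zero>"
proof -
  have c: "d \<zero> \<in> carrier R"
    using derivation_closed[OF d] by simp
  have "d \<zero> = d \<zero> \<oplus> d \<zero>"
    using derivation_add[OF d, of \<zero> \<zero>] by simp
  then show ?thesis
    using c by (metis add.l_cancel_one')
qed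

lemma derivation_one:
  assumes d: "d \<in> derivations R"
  shows "d \<one> = \<zero>"
proof -
  have c: "d \<one> \<in> carrier R"
    using derivation_closed[OF d] by simp
  have "d \<one> = d \<one> \<oplus> d \<one>"
    using derivation_mult[OF d, of \<one> \<one>] c by simp
  then show ?thesis
    using c by (metis add.l_cancel_one')
qed

end

context cring
begin

lemma derivation_pow:
  assumes d: "d \<in> derivations R" and a: "a \<in> carrier R"
  shows "d (a [^] Suc k) = [Suc k] \<cdot> (a [^] k \<otimes> d a)"
proof (induction k)
  case 0
  then show ?case
    using a derivation_closed[OF d a] by simp
next
  case (Suc k)
  have da: "d a \<in> carrier R"
    by (rule derivation_closed[OF d a])
  have "d (a [^] Suc (Suc k)) = d (a [^] Suc k) \<otimes> a \<oplus> a [^] Suc k \<otimes> d a"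
    using derivation_mult[OF d, of "a [^] Suc k" a] a by simp
  also have "d (a [^] Suc k) \<otimes> a = [Suc k] \<cdot> (a [^] k \<otimes> d a \<otimes> a)"
    unfolding Suc.IH using a da by (intro add_pow_ldistr) auto
  also have "a [^] k \<otimes> d a \<otimes> a = a [^] Suc k \<otimes> d a"
    using a da by (simp add: m_ac)
  finally show ?case
    using a da by simp
qed

lemma left_mult_derivation:
  assumes d: "d \<in> derivations R" and s: "s \<in> carrier R"
  shows "left_mult R s d \<in> derivations R"
proof (rule derivationsI)
  show "left_mult R s d \<in> carrier R \<rightarrow>\<^sub>E carrier R"
    using s derivation_closed[OF d] by (auto simp: left_mult_def)
next
  fix a b
  assume ab: "a \<in> carrier R" "b \<in> carrier R"
  note [simp] = derivation_closed[OF d ab(1)] derivation_closed[OF d ab(2)]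
  show "left_mult R s d (a \<oplus> b) = left_mult R s d a \<oplus> left_mult R s d b"
    using ab s by (simp add: left_mult_def derivation_add[OF d] r_distr)
  show "left_mult R s d (a \<otimes> b) = left_mult R s d a \<otimes> b \<oplus> a \<otimes> left_mult R s d b"
    using ab s by (simp add: left_mult_def derivation_mult[OF d] r_distr m_ac)
qed

end

lemma module_derivations:
  assumes "algebra K S"
  shows "module K (derivation_module S)"
proof -
  interpret S: algebra K S
    by (rule assms)
  have simps [simp]: "carrier (derivation_module S) = derivations S"
    "\<zero>\<^bsub>derivation_module S\<^esub> = (\<lambda>a\<in>carrier S. \<zero>\<^bsub>S\<^esub>)"
    "d \<oplus>\<^bsub>derivation_module S\<^esub> e = (\<lambda>a\<in>carrier S. d a \<oplus>\<^bsub>S\<^esub> e a)"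
    "c \<odot>\<^bsub>derivation_module S\<^esub> d = (\<lambda>a\<in>carrier S. c \<odot>\<^bsub>S\<^esub> d a)" for c d e
    by (simp_all add: derivation_module_def)
  note [simp] = derivation_closed
  have ext: "(\<lambda>a\<in>carrier S. f a) = d" if "d \<in> derivations S" "\<And>a. a \<in> carrier S \<Longrightarrow> f a = d a" for f d
    using that unfolding derivations_def by (intro ext) (auto simp: PiE_def extensional_def)
  have smult_rmult: "c \<odot>\<^bsub>S\<^esub> (a \<otimes>\<^bsub>S\<^esub> b) = a \<otimes>\<^bsub>S\<^esub> (c \<odot>\<^bsub>S\<^esub> b)"
    if "c \<in> carrier K" "a \<in> carrier S" "b \<in> carrier S" for a b c
    using that S.smult_assoc2[of c b a] by (simp add: S.m_comm)
  have zero: "(\<lambda>a\<in>carrier S. \<zero>\<^bsub>S\<^esub>) \<in> derivations S"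
    by (rule derivationsI) auto
  have smult: "(\<lambda>a\<in>carrier S. c \<odot>\<^bsub>S\<^esub> d a) \<in> derivations S"
    if "c \<in> carrier K" "d \<in> derivations S" for c d
  proof (rule derivationsI)
    fix a b
    assume "a \<in> carrier S" "b \<in> carrier S"
    then show "(\<lambda>a\<in>carrier S. c \<odot>\<^bsub>S\<^esub> d a) (a \<otimes>\<^bsub>S\<^esub> b) =
        (\<lambda>a\<in>carrier S. c \<odot>\<^bsub>S\<^esub> d a) a \<otimes>\<^bsub>S\<^esub> b \<oplus>\<^bsub>S\<^esub> a \<otimes>\<^bsub>S\<^esub> (\<lambda>a\<in>carrier S. c \<odot>\<^bsub>S\<^esub> d a) b"
      using that by (simp add: derivation_mult S.smult_r_distr S.smult_assoc2 smult_rmult)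
  qed (use that in \<open>auto simp: derivation_add S.smult_r_distr\<close>)
  have add: "(\<lambda>a\<in>carrier S. d a \<oplus>\<^bsub>S\<^esub> e a) \<in> derivations S"
    if "d \<in> derivations S" "e \<in> derivations S" for d e
  proof (rule derivationsI)
    fix a b
    assume "a \<in> carrier S" "b \<in> carrier S"
    then show "(\<lambda>a\<in>carrier S. d a \<oplus>\<^bsub>S\<^esub> e a) (a \<otimes>\<^bsub>S\<^esub> b) =
        (\<lambda>a\<in>carrier S. d a \<oplus>\<^bsub>S\<^esub> e a) a \<otimes>\<^bsub>S\<^esub> b \<oplus>\<^bsub>S\<^esub> a \<otimes>\<^bsub>S\<^esub> (\<lambda>a\<in>carrier S. d a \<oplus>\<^bsub>S\<^esub> e a) b"
      using that by (simp add: derivation_mult S.l_distr S.r_distr S.a_ac)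
  qed (use that in \<open>auto simp: derivation_add S.a_ac\<close>)
  have neg: "\<exists>e\<in>derivations S. (\<lambda>a\<in>carrier S. d a \<oplus>\<^bsub>S\<^esub> e a) = (\<lambda>a\<in>carrier S. \<zero>\<^bsub>S\<^esub>)"
    if d: "d \<in> derivations S" for d
  proof
    show "(\<lambda>a\<in>carrier S. (\<ominus>\<^bsub>K\<^esub> \<one>\<^bsub>K\<^esub>) \<odot>\<^bsub>S\<^esub> d a) \<in> derivations S"
      using smult d by blast
    show "(\<lambda>a\<in>carrier S. d a \<oplus>\<^bsub>S\<^esub> (\<lambda>a\<in>carrier S. (\<ominus>\<^bsub>K\<^esub> \<one>\<^bsub>K\<^esub>) \<odot>\<^bsub>S\<^esub> d a) a) =
        (\<lambda>a\<in>carrier S. \<zero>\<^bsub>S\<^esub>)"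
      using d by (intro restrict_ext) (simp add: S.smult_l_minus S.r_neg)
  qed
  show ?thesis
  proof (rule module_criteria, unfold simps)
    show "cring K"
      by (rule S.R_cring)
    show "\<forall>d e. d \<in> derivations S \<and> e \<in> derivations S \<longrightarrow>
        (\<lambda>a\<in>carrier S. d a \<oplus>\<^bsub>S\<^esub> e a) = (\<lambda>a\<in>carrier S. e a \<oplus>\<^bsub>S\<^esub> d a)"
      by (auto intro!: restrict_ext S.a_comm)
    show "\<forall>d e f. d \<in> derivations S \<and> e \<in> derivations S \<and> f \<in> derivations S \<longrightarrow>
        (\<lambda>a\<in>carrier S. (\<lambda>a\<in>carrier S. d a \<oplus>\<^bsub>S\<^esub> e a) a \<oplus>\<^bsub>S\<^esub> f a) =
        (\<lambda>a\<in>carrier S. d a \<oplus>\<^bsub>S\<^esub> (\<lambda>a\<in>carrier S. e a \<oplus>\<^bsub>S\<^esub> f a) a)"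
      by (auto intro!: restrict_ext S.a_assoc)
    show "\<forall>d\<in>derivations S. (\<lambda>a\<in>carrier S. d a \<oplus>\<^bsub>S\<^esub> (\<lambda>a\<in>carrier S. \<zero>\<^bsub>S\<^esub>) a) = d"
      by (auto intro!: ext)
    show "\<forall>b c d. b \<in> carrier K \<and> c \<in> carrier K \<and> d \<in> derivations S \<longrightarrow>
        (\<lambda>a\<in>carrier S. (b \<otimes>\<^bsub>K\<^esub> c) \<odot>\<^bsub>S\<^esub> d a) =
        (\<lambda>a\<in>carrier S. b \<odot>\<^bsub>S\<^esub> (\<lambda>a\<in>carrier S. c \<odot>\<^bsub>S\<^esub> d a) a)"
      by (auto intro!: restrict_ext S.smult_assoc1)
    show "\<forall>d\<in>derivations S. (\<lambda>a\<in>carrier S. \<one>\<^bsub>K\<^esub> \<odot>\<^bsub>S\<^esub> d a) = d"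
      by (auto intro!: ext)
    show "\<forall>b c d. b \<in> carrier K \<and> c \<in> carrier K \<and> d \<in> derivations S \<longrightarrow>
        (\<lambda>a\<in>carrier S. (b \<oplus>\<^bsub>K\<^esub> c) \<odot>\<^bsub>S\<^esub> d a) =
        (\<lambda>a\<in>carrier S. (\<lambda>a\<in>carrier S. b \<odot>\<^bsub>S\<^esub> d a) a \<oplus>\<^bsub>S\<^esub> (\<lambda>a\<in>carrier S. c \<odot>\<^bsub>S\<^esub> d a) a)"
      by (auto intro!: restrict_ext S.smult_l_distr)
    show "\<forall>c d e. c \<in> carrier K \<and> d \<in> derivations S \<and> e \<in> derivations S \<longrightarrow>
        (\<lambda>a\<in>carrier S. c \<odot>\<^bsub>S\<^esub> (\<lambda>a\<in>carrier S. d a \<oplus>\<^bsub>S\<^esub> e a) a) =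
        (\<lambda>a\<in>carrier S. (\<lambda>a\<in>carrier S. c \<odot>\<^bsub>S\<^esub> d a) a \<oplus>\<^bsub>S\<^esub> (\<lambda>a\<in>carrier S. c \<odot>\<^bsub>S\<^esub> e a) a)"
      by (auto intro!: restrict_ext S.smult_r_distr)
  qed (use zero smult add neg in blast)+
qed

section \<open>Bases from dual families\<close>

text \<open>Applying \<open>\<phi> i\<close> to a linear combination of the family reads off its \<open>i\<close>-th coefficient, whence
  independence. Conversely \<open>w\<close> and the combination with coefficients \<open>\<phi> i w\<close> have the same
  coordinates, so the separation hypothesis identifies them.\<close>

lemma (in vectorspace) dual_family_basis:
  fixes v :: "'i \<Rightarrow> 'c" and \<phi> :: "'i \<Rightarrow> 'c \<Rightarrow> 'a"
  assumes I: "finite I" and v: "\<And>i. i \<in> I \<Longrightarrow> v i \<in> carrier V"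
    and closed: "\<And>i w. i \<in> I \<Longrightarrow> w \<in> carrier V \<Longrightarrow> \<phi> i w \<in> carrier K"
    and add: "\<And>i w u. i \<in> I \<Longrightarrow> w \<in> carrier V \<Longrightarrow> u \<in> carrier V \<Longrightarrow>
                \<phi> i (w \<oplus>\<^bsub>V\<^esub> u) = \<phi> i w \<oplus>\<^bsub>K\<^esub> \<phi> i u"
    and smult: "\<And>i c w. i \<in> I \<Longrightarrow> c \<in> carrier K \<Longrightarrow> w \<in> carrier V \<Longrightarrow>
                  \<phi> i (c \<odot>\<^bsub>V\<^esub> w) = c \<otimes>\<^bsub>K\<^esub> \<phi> i w"
    and dual: "\<And>i j. i \<in> I \<Longrightarrow> j \<in> I \<Longrightarrow> \<phi> i (v j) = (if i = j then \<one>\<^bsub>K\<^esub> else \<zero>\<^bsub>K\<^esub>)"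
    and separating: "\<And>w. w \<in> carrier V \<Longrightarrow> (\<And>i. i \<in> I \<Longrightarrow> \<phi> i w = \<zero>\<^bsub>K\<^esub>) \<Longrightarrow> w = \<zero>\<^bsub>V\<^esub>"
  shows "inj_on v I" and "basis (v ` I)"
proof -
  show inj: "inj_on v I"
  proof (rule inj_onI)
    fix i j
    assume "i \<in> I" "j \<in> I" "v i = v j"
    then show "i = j"
      using dual[of i i] dual[of i j] by (auto split: if_splits)
  qed
  have vI: "v ` I \<subseteq> carrier V"
    using v by auto
  have zero: "\<phi> i \<zero>\<^bsub>V\<^esub> = \<zero>\<^bsub>K\<^esub>" if "i \<in> I" for i
    using smult[OF that, of "\<zero>\<^bsub>K\<^esub>" "\<zero>\<^bsub>V\<^esub>"] closed[OF that, of "\<zero>\<^bsub>V\<^esub>"] by simp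
  have sum: "\<phi> i (finsum V f T) = (\<Oplus>\<^bsub>K\<^esub>w\<in>T. \<phi> i (f w))"
    if "finite T" "f \<in> T \<rightarrow> carrier V" "i \<in> I" for f :: "'c \<Rightarrow> 'c" and T i
    using that
  proof (induction T rule: finite_induct)
    case empty
    then show ?case
      by (simp add: zero)
  next
    case (insert t T)
    then have "f \<in> T \<rightarrow> carrier V" "f t \<in> carrier V"
      by auto
    with insert show ?case
      by (simp add: add Pi_def closed)
  qed
  have coord: "\<phi> i (lincomb a (v ` I)) = a (v i)" if a: "a \<in> v ` I \<rightarrow> carrier K" and i: "i \<in> I" for a i
  proof -
    have "\<phi> i (lincomb a (v ` I)) = (\<Oplus>\<^bsub>K\<^esub>w\<in>v ` I. \<phi> i (a w \<odot>\<^bsub>V\<^esub> w))"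
      unfolding lincomb_def using I a v i by (intro sum) auto
    also have "\<dots> = (\<Oplus>\<^bsub>K\<^esub>w\<in>v ` I. if v i = w then a w else \<zero>\<^bsub>K\<^esub>)"
      using a v i inj by (intro R.finsum_cong') (auto simp: smult dual Pi_def dest: inj_onD)
    also have "\<dots> = a (v i)"
      using I a i by (intro R.finsum_singleton) auto
    finally show ?thesis .
  qed
  have "lin_indpt (v ` I)"
  proof (rule finite_lin_indpt2)
    fix a
    assume a: "a \<in> v ` I \<rightarrow> carrier K" and "lincomb a (v ` I) = \<zero>\<^bsub>V\<^esub>"
    then have "a (v i) = \<zero>\<^bsub>K\<^esub>" if "i \<in> I" for i
      using coord[OF a that] zero[OF that] by simp
    then show "\<forall>w\<in>v ` I. a w = \<zero>\<^bsub>K\<^esub>"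
      by blast
  qed (use I vI in auto)
  moreover have "w \<in> span (v ` I)" if w: "w \<in> carrier V" for w
  proof -
    \<comment> \<open>coefficients are indexed by vectors, hence the inverse of the injective map \<open>v\<close>\<close>
    define a where "a u = \<phi> (inv_into I v u) w" for u
    have a: "a \<in> v ` I \<rightarrow> carrier K"
      using w by (auto simp: a_def closed inv_into_into inj)
    define u where "u = lincomb a (v ` I)"
    have u: "u \<in> carrier V"
      unfolding u_def using a vI by (intro lincomb_closed)
    have "w \<ominus>\<^bsub>V\<^esub> u = \<zero>\<^bsub>V\<^esub>"
    proof (rule separating)
      fix i
      assume i: "i \<in> I"
      have "\<phi> i u = \<phi> i w"
        using coord[OF a i] i inj by (simp add: u_def a_def)
      moreover have "\<phi> i (w \<ominus>\<^bsub>V\<^esub> u) = \<phi> i w \<oplus>\<^bsub>K\<^esub> (\<ominus>\<^bsub>K\<^esub> \<one>\<^bsub>K\<^esub>) \<otimes>\<^bsub>K\<^esub> \<phi> i u"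
        using i w u smult[of i "\<ominus>\<^bsub>K\<^esub> \<one>\<^bsub>K\<^esub>" u]
        by (simp add: a_minus_def add smult_l_minus)
      ultimately show "\<phi> i (w \<ominus>\<^bsub>V\<^esub> u) = \<zero>\<^bsub>K\<^esub>"
        using closed[OF i w] by (simp add: R.l_minus R.r_neg)
    qed (use w u in auto)
    then have "w = u"
      using w u by simp
    then show ?thesis
      unfolding u_def using I a by (auto simp: finite_span vI)
  qed
  ultimately show "basis (v ` I)"
    unfolding basis_def using vI span_is_subset2[OF vI] by blast
qed

section \<open>Homomorphisms out of a presented group\<close>

lemma eval_word_closed:
  assumes "group L" "f \<in> I \<rightarrow> carrier L" "w \<in> lists (I \<times> UNIV)"
  shows "eval_word L f w \<in> carrier L"
proof -
  interpret L: group L by fact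
  from assms(3) show ?thesis
    by (induction w) (use assms(2) in \<open>auto simp: Pi_def\<close>)
qed

lemma eval_word_append:
  assumes "group L" "f \<in> I \<rightarrow> carrier L" "u \<in> lists (I \<times> UNIV)" "v \<in> lists (I \<times> UNIV)"
  shows "eval_word L f (u @ v) = eval_word L f u \<otimes>\<^bsub>L\<^esub> eval_word L f v"
proof -
  interpret L: group L by fact
  note closed = eval_word_closed[OF assms(1,2)]
  from assms(3) show ?thesis
  proof (induction u)
    case Nil
    then show ?case
      using closed[OF assms(4)] by simp
  next
    case (Cons a u)
    then have "fst a \<in> I" and "eval_word L f u \<in> carrier L"
      using closed by auto
    with Cons closed[OF assms(4)] assms(2) show ?case
      by (cases a) (auto simp: Pi_def L.m_assoc)
  qed
qed

text \<open>Letters outside \<open>I\<close> need not have a value in \<open>L\<close>, and transitivity may pass through any word.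
  The induction therefore also shows that equivalent words are both words over \<open>I\<close> or both not.\<close>

lemma eval_word_equiv:
  assumes L: "group L" and f: "f \<in> I \<rightarrow> carrier L" and R: "R \<subseteq> lists (I \<times> UNIV)"
    and relators: "\<And>r. r \<in> R \<Longrightarrow> eval_word L f r = \<one>\<^bsub>L\<^esub>"
    and "word_equiv I R u v"
  shows "(u \<in> lists (I \<times> UNIV) \<longleftrightarrow> v \<in> lists (I \<times> UNIV)) \<and>
         (u \<in> lists (I \<times> UNIV) \<longrightarrow> eval_word L f u = eval_word L f v)"
proof -
  interpret L: group L by fact
  note [simp] = eval_word_append[OF L f] eval_word_closed[OF L f]
  from assms(5) show ?thesis
  proof (induction rule: word_equiv.induct)
    case (word_cancel k u b v)
    then have "f k \<in> carrier L"
      using f by auto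
    then have "eval_word L f [(k, b), (k, \<not> b)] = \<one>\<^bsub>L\<^esub>"
      by simp
    moreover have "[(k, b), (k, \<not> b)] \<in> lists (I \<times> UNIV)"
      using word_cancel by simp
    ultimately show ?case
      by (metis (no_types, lifting) L.l_one append_in_lists_conv
          eval_word_append[OF L f] eval_word_closed[OF L f])
  next
    case (word_relator r u v)
    then have "r \<in> lists (I \<times> UNIV)"
      using R by auto
    with word_relator relators show ?case
      by auto
  qed auto
qed

text \<open>Von Dyck's theorem. The image of \<open>g\<close> is the value in \<open>L\<close> of any word representing \<open>g\<close>; the choice
  of the word does not matter since two such words are equivalent.\<close>

lemma presentation_hom_exists:
  assumes Q: "has_presentation Q I x R"
    and L: "group L" and f: "f \<in> I \<rightarrow> carrier L"
    and relators: "\<And>r. r \<in> R \<Longrightarrow> eval_word L f r = \<one>\<^bsub>L\<^esub>"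
  obtains \<phi> where "\<phi> \<in> hom Q L" "\<And>k. k \<in> I \<Longrightarrow> \<phi> (x k) = f k"
proof -
  let ?W = "lists (I \<times> (UNIV :: bool set))"
  have x: "x \<in> I \<rightarrow> carrier Q" and R: "R \<subseteq> ?W"
    and onto: "\<And>g. g \<in> carrier Q \<Longrightarrow> \<exists>w\<in>?W. eval_word Q x w = g"
    and eqv: "\<And>u v. u \<in> ?W \<Longrightarrow> v \<in> ?W \<Longrightarrow> eval_word Q x u = eval_word Q x v \<Longrightarrow> word_equiv I R u v"
    using Q unfolding has_presentation_def by auto
  interpret Q: group Q
    using Q unfolding has_presentation_def by blast
  interpret L: group L by fact
  define word where "word g = (SOME w. w \<in> ?W \<and> eval_word Q x w = g)" for g
  have word: "word g \<in> ?W" "eval_word Q x (word g) = g" if "g \<in> carrier Q" for g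
    using someI_ex[of "\<lambda>w. w \<in> ?W \<and> eval_word Q x w = g"] onto[OF that]
    unfolding word_def by blast+
  define \<phi> where "\<phi> g = eval_word L f (word g)" for g
  have \<phi>: "\<phi> (eval_word Q x w) = eval_word L f w" if w: "w \<in> ?W" for w
  proof -
    have c: "eval_word Q x w \<in> carrier Q"
      by (rule eval_word_closed[OF Q.is_group x w])
    show ?thesis
      unfolding \<phi>_def using eval_word_equiv[OF L f R relators eqv] word[OF c] w by blast
  qed
  have "\<phi> \<in> hom Q L"
  proof (rule homI)
    show "\<phi> g \<in> carrier L" if "g \<in> carrier Q" for g
      unfolding \<phi>_def by (rule eval_word_closed[OF L f word(1)[OF that]])
  next
    fix g h
    assume gh: "g \<in> carrier Q" "h \<in> carrier Q"
    have "\<phi> (g \<otimes>\<^bsub>Q\<^esub> h) = \<phi> (eval_word Q x (word g @ word h))"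
      using gh word by (simp add: eval_word_append[OF Q.is_group x])
    also have "\<dots> = eval_word L f (word g @ word h)"
      using gh word(1) by (intro \<phi>) auto
    also have "\<dots> = \<phi> g \<otimes>\<^bsub>L\<^esub> \<phi> h"
      using gh word(1) by (simp add: eval_word_append[OF L f] \<phi>_def)
    finally show "\<phi> (g \<otimes>\<^bsub>Q\<^esub> h) = \<phi> g \<otimes>\<^bsub>L\<^esub> \<phi> h" .
  qed
  moreover have "\<phi> (x k) = f k" if "k \<in> I" for k
    using \<phi>[of "[(k, True)]"] that x f by (auto simp: Pi_def)
  ultimately show ?thesis
    by (rule that)
qed

lemma eval_power_relator:
  assumes "group L" "f k \<in> carrier L"
  shows "eval_word L f (power_relator k e) = f k [^]\<^bsub>L\<^esub> e"
proof -
  interpret L: group L by fact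
  show ?thesis
    unfolding power_relator_def
  proof (induction e)
    case (Suc e)
    then show ?case
      using L.nat_pow_Suc2[OF assms(2), of e] by simp
  qed simp
qed

lemma eval_commutator_relator:
  assumes "comm_group L" "f k \<in> carrier L" "f l \<in> carrier L"
  shows "eval_word L f (commutator_relator k l) = \<one>\<^bsub>L\<^esub>"
proof -
  interpret L: comm_group L by fact
  have "eval_word L f (commutator_relator k l) =
      (inv\<^bsub>L\<^esub> f k \<otimes>\<^bsub>L\<^esub> f k) \<otimes>\<^bsub>L\<^esub> (inv\<^bsub>L\<^esub> f l \<otimes>\<^bsub>L\<^esub> f l)"
    using assms(2,3) unfolding commutator_relator_def by (simp add: L.m_ac)
  then show ?thesis
    using assms(2,3) by simp
qed

section \<open>Finite fields and scalars\<close>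

lemma (in field) finite_field_pow_order:
  assumes "finite (carrier R)" "c \<in> carrier R"
  shows "c [^] order R = c"
proof (cases "c = \<zero>")
  case True
  have "order R > 0"
    using assms by (auto simp: order_def card_gt_0_iff)
  then show ?thesis
    using True by (metis Suc_pred nat_pow_Suc nat_pow_closed r_null zero_closed)
next
  case False
  then have c: "c \<in> carrier (mult_of R)"
    using assms(2) by (simp add: carrier_mult_of)
  interpret U: group "mult_of R"
    by (rule field_mult_group)
  have "c [^] (order R - 1) = \<one>"
    using U.pow_order_eq_1[OF c] by (simp add: order_mult_of assms(1) nat_pow_mult_of one_mult_of)
  moreover have "order R > 0"
    using assms by (auto simp: order_def card_gt_0_iff)
  ultimately show ?thesis
    using assms(2) by (metis Suc_pred' l_one nat_pow_Suc)
qed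

lemma ring_characteristic_dvd_order:
  assumes "ring K"
  shows "ring_characteristic K dvd order K"
proof -
  interpret K: ring K by fact
  show ?thesis
    using K.add.ord_dvd_group_order[OF K.one_closed]
    by (simp add: ring_characteristic_def order_def)
qed

lemma add_pow_one_eq_zero_iff:
  fixes n :: nat
  assumes "ring K"
  shows "[n] \<cdot>\<^bsub>K\<^esub> \<one>\<^bsub>K\<^esub> = \<zero>\<^bsub>K\<^esub> \<longleftrightarrow> ring_characteristic K dvd n"
proof -
  interpret K: ring K by fact
  show ?thesis
    using K.add.pow_eq_id[OF K.one_closed, of n]
    by (simp add: ring_characteristic_def)
qed

context algebra
begin

lemma add_pow_eq_smult:
  fixes n :: nat
  assumes "s \<in> carrier M"
  shows "[n] \<cdot>\<^bsub>M\<^esub> s = ([n] \<cdot> \<one>) \<odot>\<^bsub>M\<^esub> s"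
  by (induction n) (use assms in \<open>simp_all add: smult_l_distr\<close>)

lemma smult_one_pow:
  fixes n :: nat
  assumes "c \<in> carrier R"
  shows "(c \<odot>\<^bsub>M\<^esub> \<one>\<^bsub>M\<^esub>) [^]\<^bsub>M\<^esub> n = (c [^] n) \<odot>\<^bsub>M\<^esub> \<one>\<^bsub>M\<^esub>"
proof (induction n)
  case (Suc n)
  then show ?case
    using assms by (simp add: smult_assoc2 smult_assoc1)
qed simp

end

text \<open>In a finite field \<open>c = c ^ card K\<close>, so \<open>d (c \<cdot> 1)\<close> carries the factor \<open>card K\<close>, a multiple of
  the characteristic.\<close>

lemma derivation_scalar:
  assumes "algebra K S" "field K" "finite (carrier K)"
    and d: "d \<in> derivations S" and c: "c \<in> carrier K"
  shows "d (c \<odot>\<^bsub>S\<^esub> \<one>\<^bsub>S\<^esub>) = \<zero>\<^bsub>S\<^esub>"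
proof -
  interpret S: algebra K S by fact
  interpret K: field K by fact
  have cS: "c \<odot>\<^bsub>S\<^esub> \<one>\<^bsub>S\<^esub> \<in> carrier S"
    using c by simp
  have "order K > 0"
    using assms(3) by (auto simp: order_def card_gt_0_iff)
  then obtain k where k: "order K = Suc k"
    by (cases "order K") auto
  have "c \<odot>\<^bsub>S\<^esub> \<one>\<^bsub>S\<^esub> = (c \<odot>\<^bsub>S\<^esub> \<one>\<^bsub>S\<^esub>) [^]\<^bsub>S\<^esub> Suc k"
    unfolding S.smult_one_pow[OF c] k[symmetric]
    using K.finite_field_pow_order[OF assms(3) c] by simp
  then have "d (c \<odot>\<^bsub>S\<^esub> \<one>\<^bsub>S\<^esub>) =
      [Suc k] \<cdot>\<^bsub>S\<^esub> ((c \<odot>\<^bsub>S\<^esub> \<one>\<^bsub>S\<^esub>) [^]\<^bsub>S\<^esub> k \<otimes>\<^bsub>S\<^esub> d (c \<odot>\<^bsub>S\<^esub> \<one>\<^bsub>S\<^esub>))"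
    using S.derivation_pow[OF d cS, of k] by simp
  also have "\<dots> = ([Suc k] \<cdot>\<^bsub>K\<^esub> \<one>\<^bsub>K\<^esub>) \<odot>\<^bsub>S\<^esub> ((c \<odot>\<^bsub>S\<^esub> \<one>\<^bsub>S\<^esub>) [^]\<^bsub>S\<^esub> k \<otimes>\<^bsub>S\<^esub> d (c \<odot>\<^bsub>S\<^esub> \<one>\<^bsub>S\<^esub>))"
    using derivation_closed[OF d cS] cS by (intro S.add_pow_eq_smult) simp
  also have "[Suc k] \<cdot>\<^bsub>K\<^esub> \<one>\<^bsub>K\<^esub> = \<zero>\<^bsub>K\<^esub>"
    unfolding add_pow_one_eq_zero_iff[OF K.is_ring]
    using ring_characteristic_dvd_order[OF K.is_ring] k by simp
  finally show ?thesis
    using derivation_closed[OF d cS] cS by simp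
qed

lemma derivation_smult:
  assumes "algebra K S" "field K" "finite (carrier K)"
    and d: "d \<in> derivations S" and c: "c \<in> carrier K" and a: "a \<in> carrier S"
  shows "d (c \<odot>\<^bsub>S\<^esub> a) = c \<odot>\<^bsub>S\<^esub> d a"
proof -
  interpret S: algebra K S by fact
  have da: "d a \<in> carrier S"
    by (rule derivation_closed[OF d a])
  have "d (c \<odot>\<^bsub>S\<^esub> a) = d ((c \<odot>\<^bsub>S\<^esub> \<one>\<^bsub>S\<^esub>) \<otimes>\<^bsub>S\<^esub> a)"
    using c a by (simp add: S.smult_assoc2)
  also have "\<dots> = (c \<odot>\<^bsub>S\<^esub> \<one>\<^bsub>S\<^esub>) \<otimes>\<^bsub>S\<^esub> d a"
    using derivation_mult[OF d, of "c \<odot>\<^bsub>S\<^esub> \<one>\<^bsub>S\<^esub>" a] derivation_scalar[OF assms(1-3) d c] c a da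
    by simp
  also have "\<dots> = c \<odot>\<^bsub>S\<^esub> d a"
    using c da by (simp add: S.smult_assoc2)
  finally show ?thesis .
qed

text \<open>Differentiating \<open>u ^ r = c \<cdot> 1\<close> gives \<open>r u ^ (r - 1) d u = 0\<close>, where both \<open>r\<close> and \<open>u\<close> are
  invertible.\<close>

lemma derivation_unit_root_of_scalar:
  assumes "algebra K S" "field K" "finite (carrier K)" and d: "d \<in> derivations S"
    and u: "u \<in> Units S" and c: "c \<in> carrier K" and r: "\<not> ring_characteristic K dvd r"
    and eq: "u [^]\<^bsub>S\<^esub> r = c \<odot>\<^bsub>S\<^esub> \<one>\<^bsub>S\<^esub>"
  shows "d u = \<zero>\<^bsub>S\<^esub>"
proof -
  interpret S: algebra K S by fact
  interpret K: field K by fact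
  have uS: "u \<in> carrier S" and du: "d u \<in> carrier S"
    using u derivation_closed[OF d] by auto
  obtain k where k: "r = Suc k"
    using r by (cases r) auto
  define e where "e = [r] \<cdot>\<^bsub>K\<^esub> \<one>\<^bsub>K\<^esub>"
  have e: "e \<in> Units K"
    using r by (simp add: e_def add_pow_one_eq_zero_iff[OF K.is_ring] K.field_Units)
  define w where "w = u [^]\<^bsub>S\<^esub> k \<otimes>\<^bsub>S\<^esub> d u"
  have w: "w \<in> carrier S"
    using uS du by (simp add: w_def)
  have "e \<odot>\<^bsub>S\<^esub> w = d (u [^]\<^bsub>S\<^esub> r)"
    unfolding k S.derivation_pow[OF d uS] e_def w_def[symmetric]
    by (rule S.add_pow_eq_smult[OF w, symmetric])
  also have "\<dots> = \<zero>\<^bsub>S\<^esub>"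
    unfolding eq by (rule derivation_scalar[OF assms(1-3) d c])
  finally have "e \<odot>\<^bsub>S\<^esub> w = \<zero>\<^bsub>S\<^esub>" .
  moreover have "inv\<^bsub>K\<^esub> e \<odot>\<^bsub>S\<^esub> (e \<odot>\<^bsub>S\<^esub> w) = w"
    using e w S.smult_assoc1[of "inv\<^bsub>K\<^esub> e" e w] S.R.Units_closed[OF e] by simp
  ultimately have "w = \<zero>\<^bsub>S\<^esub>"
    using e by simp
  moreover have "u [^]\<^bsub>S\<^esub> k \<in> Units S"
    using u by (rule S.Units_pow_closed)
  ultimately show ?thesis
    unfolding w_def using du by (metis S.Units_closed S.Units_l_cancel S.r_null S.zero_closed)
qed


section \<open>Symmetric cocycles\<close>

text \<open>Multiplicativity in \<open>h\<close> comes from combining the cocycle identities for the triples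
  \<open>(g, h, k)\<close>, \<open>(h, g, k)\<close> and \<open>(h, k, g)\<close>; the values \<open>\<alpha> (g h) k\<close>, \<open>\<alpha> h (g k)\<close> and \<open>\<alpha> h k\<close>
  cancel because \<open>G\<close> is abelian.\<close>

lemma commutator_pairing_hom:
  assumes "cring K" "comm_group G" "two_cocycle K G \<alpha>" and g: "g \<in> carrier G"
  shows "(\<lambda>h. \<alpha> g h \<otimes>\<^bsub>K\<^esub> inv\<^bsub>K\<^esub> (\<alpha> h g)) \<in> hom G (units_of K)"
proof (rule homI)
  interpret K: cring K by fact
  interpret G: comm_group G by fact
  have unit: "\<alpha> h k \<in> Units K" if "h \<in> carrier G" "k \<in> carrier G" for h k
    using assms(3) that unfolding two_cocycle_def by (auto simp: Pi_def)
  have cocycle: "\<alpha> x y \<otimes>\<^bsub>K\<^esub> \<alpha> (x \<otimes>\<^bsub>G\<^esub> y) z = \<alpha> y z \<otimes>\<^bsub>K\<^esub> \<alpha> x (y \<otimes>\<^bsub>G\<^esub> z)"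
    if "x \<in> carrier G" "y \<in> carrier G" "z \<in> carrier G" for x y z
    using assms(3) that unfolding two_cocycle_def by blast
  show "\<alpha> g h \<otimes>\<^bsub>K\<^esub> inv\<^bsub>K\<^esub> (\<alpha> h g) \<in> carrier (units_of K)" if "h \<in> carrier G" for h
    using unit g that by (simp add: units_of_carrier)
  fix h k
  assume h: "h \<in> carrier G" and k: "k \<in> carrier G"
  note units = unit[OF g h] unit[OF h g] unit[OF g k] unit[OF k g]
    unit[OF h k] unit[OF g G.m_closed[OF h k]] unit[OF G.m_closed[OF h k] g]
    unit[OF G.m_closed[OF g h] k] unit[OF h G.m_closed[OF g k]]
  note c = units[THEN K.Units_closed]
  note inv_c = units[THEN K.Units_inv_closed]
  have 1: "\<alpha> g h \<otimes>\<^bsub>K\<^esub> \<alpha> (g \<otimes>\<^bsub>G\<^esub> h) k = \<alpha> h k \<otimes>\<^bsub>K\<^esub> \<alpha> g (h \<otimes>\<^bsub>G\<^esub> k)"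
    by (rule cocycle[OF g h k])
  have 2: "\<alpha> h g \<otimes>\<^bsub>K\<^esub> \<alpha> (g \<otimes>\<^bsub>G\<^esub> h) k = \<alpha> g k \<otimes>\<^bsub>K\<^esub> \<alpha> h (g \<otimes>\<^bsub>G\<^esub> k)"
    using cocycle[OF h g k] by (simp add: G.m_comm[OF h g])
  have 3: "\<alpha> h k \<otimes>\<^bsub>K\<^esub> \<alpha> (h \<otimes>\<^bsub>G\<^esub> k) g = \<alpha> k g \<otimes>\<^bsub>K\<^esub> \<alpha> h (g \<otimes>\<^bsub>G\<^esub> k)"
    using cocycle[OF h k g] by (simp add: G.m_comm[OF k g])
  let ?P = "\<alpha> (g \<otimes>\<^bsub>G\<^esub> h) k" and ?Q = "\<alpha> h (g \<otimes>\<^bsub>G\<^esub> k)"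
  have "\<alpha> h k \<otimes>\<^bsub>K\<^esub> (\<alpha> g (h \<otimes>\<^bsub>G\<^esub> k) \<otimes>\<^bsub>K\<^esub> (\<alpha> h g \<otimes>\<^bsub>K\<^esub> \<alpha> k g)) =
      (\<alpha> h k \<otimes>\<^bsub>K\<^esub> \<alpha> g (h \<otimes>\<^bsub>G\<^esub> k)) \<otimes>\<^bsub>K\<^esub> (\<alpha> h g \<otimes>\<^bsub>K\<^esub> \<alpha> k g)"
    using c by (simp add: K.m_assoc)
  also have "\<dots> = (\<alpha> h g \<otimes>\<^bsub>K\<^esub> ?P) \<otimes>\<^bsub>K\<^esub> (\<alpha> g h \<otimes>\<^bsub>K\<^esub> \<alpha> k g)"
    unfolding 1[symmetric] using c by (simp add: K.m_ac)
  also have "\<dots> = (\<alpha> k g \<otimes>\<^bsub>K\<^esub> ?Q) \<otimes>\<^bsub>K\<^esub> (\<alpha> g h \<otimes>\<^bsub>K\<^esub> \<alpha> g k)"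
    unfolding 2 using c by (simp add: K.m_ac)
  also have "\<dots> = \<alpha> h k \<otimes>\<^bsub>K\<^esub> (\<alpha> (h \<otimes>\<^bsub>G\<^esub> k) g \<otimes>\<^bsub>K\<^esub> (\<alpha> g h \<otimes>\<^bsub>K\<^esub> \<alpha> g k))"
    unfolding 3[symmetric] using c by (simp add: K.m_assoc)
  finally have cross: "\<alpha> g (h \<otimes>\<^bsub>G\<^esub> k) \<otimes>\<^bsub>K\<^esub> (\<alpha> h g \<otimes>\<^bsub>K\<^esub> \<alpha> k g) =
      \<alpha> (h \<otimes>\<^bsub>G\<^esub> k) g \<otimes>\<^bsub>K\<^esub> (\<alpha> g h \<otimes>\<^bsub>K\<^esub> \<alpha> g k)"
    using c units by simp
  let ?i = "\<lambda>a b. inv\<^bsub>K\<^esub> (\<alpha> a b)"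
  have "\<alpha> g (h \<otimes>\<^bsub>G\<^esub> k) \<otimes>\<^bsub>K\<^esub> ?i (h \<otimes>\<^bsub>G\<^esub> k) g =
      \<alpha> g (h \<otimes>\<^bsub>G\<^esub> k) \<otimes>\<^bsub>K\<^esub> ?i (h \<otimes>\<^bsub>G\<^esub> k) g \<otimes>\<^bsub>K\<^esub> (\<alpha> h g \<otimes>\<^bsub>K\<^esub> ?i h g) \<otimes>\<^bsub>K\<^esub> (\<alpha> k g \<otimes>\<^bsub>K\<^esub> ?i k g)"
    using c inv_c units by simp
  also have "\<dots> = (\<alpha> g (h \<otimes>\<^bsub>G\<^esub> k) \<otimes>\<^bsub>K\<^esub> (\<alpha> h g \<otimes>\<^bsub>K\<^esub> \<alpha> k g)) \<otimes>\<^bsub>K\<^esub> (?i (h \<otimes>\<^bsub>G\<^esub> k) g \<otimes>\<^bsub>K\<^esub> ?i h g \<otimes>\<^bsub>K\<^esub> ?i k g)"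
    using c inv_c by (simp add: K.m_ac del: K.Units_r_inv)
  also have "\<dots> = (\<alpha> g h \<otimes>\<^bsub>K\<^esub> ?i h g) \<otimes>\<^bsub>K\<^esub> (\<alpha> g k \<otimes>\<^bsub>K\<^esub> ?i k g) \<otimes>\<^bsub>K\<^esub> (\<alpha> (h \<otimes>\<^bsub>G\<^esub> k) g \<otimes>\<^bsub>K\<^esub> ?i (h \<otimes>\<^bsub>G\<^esub> k) g)"
    unfolding cross using c inv_c by (simp add: K.m_ac del: K.Units_r_inv)
  also have "\<dots> = (\<alpha> g h \<otimes>\<^bsub>K\<^esub> ?i h g) \<otimes>\<^bsub>K\<^esub> (\<alpha> g k \<otimes>\<^bsub>K\<^esub> ?i k g)"
    using c inv_c units by simp
  finally show "\<alpha> g (h \<otimes>\<^bsub>G\<^esub> k) \<otimes>\<^bsub>K\<^esub> ?i (h \<otimes>\<^bsub>G\<^esub> k) g =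
      (\<alpha> g h \<otimes>\<^bsub>K\<^esub> ?i h g) \<otimes>\<^bsub>units_of K\<^esub> (\<alpha> g k \<otimes>\<^bsub>K\<^esub> ?i k g)"
    by (simp add: units_of_mult)
qed

lemma commutator_pairing_eq_one_iff:
  assumes "cring K" "two_cocycle K G \<alpha>" "g \<in> carrier G" "h \<in> carrier G"
  shows "\<alpha> g h \<otimes>\<^bsub>K\<^esub> inv\<^bsub>K\<^esub> (\<alpha> h g) = \<one>\<^bsub>K\<^esub> \<longleftrightarrow> \<alpha> g h = \<alpha> h g"
proof -
  interpret K: cring K by fact
  have unit: "\<alpha> h k \<in> Units K" if "h \<in> carrier G" "k \<in> carrier G" for h k
    using assms(2) that unfolding two_cocycle_def by (auto simp: Pi_def)
  show ?thesis
    using unit[OF assms(3,4)] unit[OF assms(4,3)]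
    by (metis K.Units_closed K.Units_inv_closed K.Units_l_inv K.Units_r_inv K.l_one K.m_assoc K.r_one)
qed

text \<open>The pairing of \<open>g\<close> with \<open>y\<close> is a unit of \<open>K\<close> whose order divides both a power of the
  characteristic and \<open>card K - 1\<close>. These are coprime, since the characteristic divides \<open>card K\<close>.\<close>

lemma cocycle_symmetric_p_element:
  assumes "field K" "finite (carrier K)" "comm_group G" "two_cocycle K G \<alpha>"
    and g: "g \<in> carrier G" and y: "y \<in> carrier G"
    and ord: "group.ord G y = ring_characteristic K ^ k"
  shows "\<alpha> g y = \<alpha> y g"
proof -
  interpret K: field K by fact
  interpret G: comm_group G by fact
  interpret U: comm_group "units_of K"
    by (rule K.units_comm_group)
  define \<beta> where "\<beta> h = \<alpha> g h \<otimes>\<^bsub>K\<^esub> inv\<^bsub>K\<^esub> (\<alpha> h g)" for h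
  interpret \<beta>: group_hom G "units_of K" \<beta>
    unfolding \<beta>_def
    by (intro group_hom.intro group_hom_axioms.intro commutator_pairing_hom)
      (use g assms in \<open>simp_all add: K.is_cring G.is_group U.is_group\<close>)
  have \<beta>y: "\<beta> y \<in> carrier (units_of K)"
    using y by simp
  have "\<beta> y [^]\<^bsub>units_of K\<^esub> (ring_characteristic K ^ k) = \<beta> (y [^]\<^bsub>G\<^esub> G.ord y)"
    using y by (simp add: \<beta>.hom_nat_pow ord del: G.pow_ord_eq_1)
  also have "\<dots> = \<one>\<^bsub>units_of K\<^esub>"
    using y by simp
  finally have dvd1: "U.ord (\<beta> y) dvd ring_characteristic K ^ k"
    using \<beta>y by (simp add: U.pow_eq_id)
  have "order (units_of K) = order K - 1"
    using assms(2) by (simp add: order_def units_of_carrier K.field_Units card_Diff_singleton)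
  with U.ord_dvd_group_order[OF \<beta>y] have dvd2: "U.ord (\<beta> y) dvd order K - 1"
    by simp
  have "order K > 0"
    using assms(2) by (auto simp: order_def card_gt_0_iff)
  then have "coprime (order K) (order K - 1)"
    by (rule coprime_diff_one_right_nat)
  then have "coprime (ring_characteristic K) (order K - 1)"
    by (rule coprime_divisors[OF ring_characteristic_dvd_order[OF K.is_ring] dvd_refl])
  then have "coprime (ring_characteristic K ^ k) (order K - 1)"
    by (simp add: coprime_power_left_iff)
  from coprime_common_divisor[OF this dvd1 dvd2] have "U.ord (\<beta> y) = 1"
    by simp
  then have "\<beta> y = \<one>\<^bsub>K\<^esub>"
    using U.ord_eq_1[OF \<beta>y] by (simp add: units_of_one)
  then show ?thesis
    unfolding \<beta>_def commutator_pairing_eq_one_iff[OF K.is_cring assms(4) g y] .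
qed

section \<open>Twisted group algebras of symmetric cocycles\<close>

locale symmetric_twisted_group_ring = K: field K + G: comm_group G
  for K :: "('k, 'r) ring_scheme" (structure) and G :: "('g, 's) monoid_scheme"
    and \<alpha> :: "'g \<Rightarrow> 'g \<Rightarrow> 'k" +
  assumes finite_G: "finite (carrier G)"
    and cocycle: "two_cocycle K G \<alpha>"
    and normalized: "normalized_cocycle K G \<alpha>"
    and symmetric: "g \<in> carrier G \<Longrightarrow> h \<in> carrier G \<Longrightarrow> \<alpha> g h = \<alpha> h g"
begin

abbreviation A where "A \<equiv> twisted_group_ring K G \<alpha>"

abbreviation B where "B \<equiv> basis_elem K G"

lemma cocycle_Units: "g \<in> carrier G \<Longrightarrow> h \<in> carrier G \<Longrightarrow> \<alpha> g h \<in> Units K"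
  using cocycle unfolding two_cocycle_def by (auto simp: Pi_def)

lemma cocycle_closed [simp]: "g \<in> carrier G \<Longrightarrow> h \<in> carrier G \<Longrightarrow> \<alpha> g h \<in> carrier K"
  using cocycle_Units K.Units_closed by blast

lemma cocycle_eq:
  "x \<in> carrier G \<Longrightarrow> y \<in> carrier G \<Longrightarrow> z \<in> carrier G \<Longrightarrow>
     \<alpha> x y \<otimes> \<alpha> (x \<otimes>\<^bsub>G\<^esub> y) z = \<alpha> y z \<otimes> \<alpha> x (y \<otimes>\<^bsub>G\<^esub> z)"
  using cocycle unfolding two_cocycle_def by blast

lemma cocycle_one [simp]: "g \<in> carrier G \<Longrightarrow> \<alpha> \<one>\<^bsub>G\<^esub> g = \<one>"
  using normalized unfolding normalized_cocycle_def by blast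

lemma A_carrier: "carrier A = carrier G \<rightarrow>\<^sub>E carrier K"
  and A_add: "a \<oplus>\<^bsub>A\<^esub> b = (\<lambda>g\<in>carrier G. a g \<oplus> b g)"
  and A_smult: "c \<odot>\<^bsub>A\<^esub> a = (\<lambda>g\<in>carrier G. c \<otimes> a g)"
  and A_zero: "\<zero>\<^bsub>A\<^esub> = (\<lambda>g\<in>carrier G. \<zero>)"
  and A_one: "\<one>\<^bsub>A\<^esub> = B \<one>\<^bsub>G\<^esub>"
  by (simp_all add: twisted_group_ring_def)

lemma coeff_closed [simp]: "a \<in> carrier A \<Longrightarrow> g \<in> carrier G \<Longrightarrow> a g \<in> carrier K"
  unfolding A_carrier by blast

lemma coeff_add [simp]: "g \<in> carrier G \<Longrightarrow> (a \<oplus>\<^bsub>A\<^esub> b) g = a g \<oplus> b g"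
  and coeff_smult [simp]: "g \<in> carrier G \<Longrightarrow> (c \<odot>\<^bsub>A\<^esub> a) g = c \<otimes> a g"
  and coeff_zero [simp]: "g \<in> carrier G \<Longrightarrow> \<zero>\<^bsub>A\<^esub> g = \<zero>"
  and coeff_basis [simp]: "h \<in> carrier G \<Longrightarrow> B g h = (if h = g then \<one> else \<zero>)"
  by (simp_all add: A_add A_smult A_zero basis_elem_def)

lemma A_eqI:
  assumes "a \<in> carrier A" "b \<in> carrier A" "\<And>g. g \<in> carrier G \<Longrightarrow> a g = b g"
  shows "a = b"
  using assms unfolding A_carrier by (rule PiE_ext)

lemma basis_closed [simp]: "B g \<in> carrier A"
  by (auto simp: A_carrier basis_elem_def)

text \<open>The factorisations \<open>z = x y\<close> in the definition of the product are indexed here by their first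
  factor, so that the sum runs over the fixed set \<open>carrier G\<close>.\<close>

lemma coeff_mult:
  assumes a: "a \<in> carrier A" and b: "b \<in> carrier A" and z: "z \<in> carrier G"
  shows "(a \<otimes>\<^bsub>A\<^esub> b) z =
    (\<Oplus>x\<in>carrier G. a x \<otimes> b (inv\<^bsub>G\<^esub> x \<otimes>\<^bsub>G\<^esub> z) \<otimes> \<alpha> x (inv\<^bsub>G\<^esub> x \<otimes>\<^bsub>G\<^esub> z))"
proof -
  let ?D = "{(x, y). x \<in> carrier G \<and> y \<in> carrier G \<and> x \<otimes>\<^bsub>G\<^esub> y = z}"
  let ?h = "\<lambda>x. (x, inv\<^bsub>G\<^esub> x \<otimes>\<^bsub>G\<^esub> z)"
  have D: "?D = ?h ` carrier G"
    using z by (auto simp: image_iff simp flip: G.m_assoc)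
  have inj: "inj_on ?h (carrier G)"
    by (rule inj_onI) simp
  have "(a \<otimes>\<^bsub>A\<^esub> b) z = finsum K (\<lambda>(x, y). a x \<otimes> b y \<otimes> \<alpha> x y) ?D"
    using z by (simp add: twisted_group_ring_def)
  also have "\<dots> = (\<Oplus>x\<in>carrier G. (\<lambda>(x, y). a x \<otimes> b y \<otimes> \<alpha> x y) (?h x))"
    unfolding D using a b z by (intro K.finsum_reindex inj) auto
  finally show ?thesis
    by simp
qed

lemma A_module: "module K A"
proof (rule module_criteria)
  show "cring K"
    by (rule K.is_cring)
  show "\<forall>a\<in>carrier A. \<exists>b\<in>carrier A. a \<oplus>\<^bsub>A\<^esub> b = \<zero>\<^bsub>A\<^esub>"
  proof
    fix a
    assume a: "a \<in> carrier A"
    have "(\<lambda>g\<in>carrier G. \<ominus> a g) \<in> carrier A"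
      using a by (auto simp: A_carrier)
    moreover have "a \<oplus>\<^bsub>A\<^esub> (\<lambda>g\<in>carrier G. \<ominus> a g) = \<zero>\<^bsub>A\<^esub>"
      unfolding A_add A_zero using a by (intro restrict_ext) (simp add: K.r_neg)
    ultimately show "\<exists>b\<in>carrier A. a \<oplus>\<^bsub>A\<^esub> b = \<zero>\<^bsub>A\<^esub>"
      by blast
  qed
  show "\<forall>a b c. a \<in> carrier A \<and> b \<in> carrier A \<and> c \<in> carrier A \<longrightarrow>
      a \<oplus>\<^bsub>A\<^esub> b \<oplus>\<^bsub>A\<^esub> c = a \<oplus>\<^bsub>A\<^esub> (b \<oplus>\<^bsub>A\<^esub> c)"
    by (auto simp: A_add K.a_assoc intro!: restrict_ext)
  show "\<forall>a b. a \<in> carrier A \<and> b \<in> carrier A \<longrightarrow> a \<oplus>\<^bsub>A\<^esub> b = b \<oplus>\<^bsub>A\<^esub> a"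
    by (auto simp: A_add K.a_comm intro!: restrict_ext)
  show "\<forall>a\<in>carrier A. a \<oplus>\<^bsub>A\<^esub> \<zero>\<^bsub>A\<^esub> = a"
    by (intro ballI A_eqI) (auto simp: A_carrier A_add A_zero)
  show "\<forall>a\<in>carrier A. \<one> \<odot>\<^bsub>A\<^esub> a = a"
    by (intro ballI A_eqI) (auto simp: A_carrier A_smult)
  show "\<forall>c d a. c \<in> carrier K \<and> d \<in> carrier K \<and> a \<in> carrier A \<longrightarrow>
      (c \<otimes> d) \<odot>\<^bsub>A\<^esub> a = c \<odot>\<^bsub>A\<^esub> (d \<odot>\<^bsub>A\<^esub> a)"
    by (auto simp: A_smult K.m_assoc intro!: restrict_ext)
  show "\<forall>c d a. c \<in> carrier K \<and> d \<in> carrier K \<and> a \<in> carrier A \<longrightarrow>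
      (c \<oplus> d) \<odot>\<^bsub>A\<^esub> a = c \<odot>\<^bsub>A\<^esub> a \<oplus>\<^bsub>A\<^esub> d \<odot>\<^bsub>A\<^esub> a"
    by (auto simp: A_smult A_add K.l_distr intro!: restrict_ext)
  show "\<forall>c a b. c \<in> carrier K \<and> a \<in> carrier A \<and> b \<in> carrier A \<longrightarrow>
      c \<odot>\<^bsub>A\<^esub> (a \<oplus>\<^bsub>A\<^esub> b) = c \<odot>\<^bsub>A\<^esub> a \<oplus>\<^bsub>A\<^esub> c \<odot>\<^bsub>A\<^esub> b"
    by (auto simp: A_smult A_add K.r_distr intro!: restrict_ext)
qed (auto simp: A_carrier A_add A_smult A_zero)

sublocale A: module K A
  by (rule A_module)

text \<open>By this principle an identity between (multi)linear expressions need only be checked on the basis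
  elements, where products are governed by \<open>\<alpha>\<close>: commutativity of \<open>A\<close> becomes symmetry of
  \<open>\<alpha>\<close>, and associativity the cocycle identity.\<close>

lemma basis_induct [consumes 1, case_names zero step]:
  assumes a: "a \<in> carrier A"
    and zero: "P \<zero>\<^bsub>A\<^esub>"
    and step: "\<And>a c g. a \<in> carrier A \<Longrightarrow> P a \<Longrightarrow> c \<in> carrier K \<Longrightarrow> g \<in> carrier G \<Longrightarrow>
                 P (a \<oplus>\<^bsub>A\<^esub> c \<odot>\<^bsub>A\<^esub> B g)"
  shows "P a"
proof -
  have "P a" if "finite F" "F \<subseteq> carrier G" "a \<in> carrier A"
    "\<And>g. g \<in> carrier G \<Longrightarrow> g \<notin> F \<Longrightarrow> a g = \<zero>" for F a
    using that
  proof (induction F arbitrary: a rule: finite_induct)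
    case empty
    then have "a = \<zero>\<^bsub>A\<^esub>"
      by (intro A_eqI) auto
    then show ?case
      using zero by simp
  next
    case (insert h F)
    \<comment> \<open>remove one coefficient, so that the support shrinks to \<open>F\<close>\<close>
    define b where "b = (\<lambda>g\<in>carrier G. if g = h then \<zero> else a g)"
    have b: "b \<in> carrier A"
      using insert.prems(2) by (auto simp: b_def A_carrier)
    have h: "h \<in> carrier G"
      using insert.prems(1) by simp
    have "a = b \<oplus>\<^bsub>A\<^esub> a h \<odot>\<^bsub>A\<^esub> B h"
      using insert.prems(2) b h by (intro A_eqI) (auto simp: b_def)
    moreover have "P b"
      using insert.prems by (intro insert.IH b) (auto simp: b_def)
    ultimately show ?case
      using step[OF b] insert.prems(2) h by (metis coeff_closed)
  qed
  from this[OF finite_G subset_refl a] show ?thesis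
    by blast
qed

lemma mult_closed: "a \<in> carrier A \<Longrightarrow> b \<in> carrier A \<Longrightarrow> a \<otimes>\<^bsub>A\<^esub> b \<in> carrier A"
proof -
  assume a: "a \<in> carrier A" and b: "b \<in> carrier A"
  have "(a \<otimes>\<^bsub>A\<^esub> b) z \<in> carrier K" if "z \<in> carrier G" for z
    unfolding coeff_mult[OF a b that] using a b that by (intro K.finsum_closed) auto
  then show ?thesis
    by (auto simp: A_carrier twisted_group_ring_def)
qed

lemma mult_add_left:
  assumes "a \<in> carrier A" "b \<in> carrier A" "c \<in> carrier A"
  shows "(a \<oplus>\<^bsub>A\<^esub> b) \<otimes>\<^bsub>A\<^esub> c = a \<otimes>\<^bsub>A\<^esub> c \<oplus>\<^bsub>A\<^esub> b \<otimes>\<^bsub>A\<^esub> c"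
proof (rule A_eqI)
  fix z
  assume z: "z \<in> carrier G"
  let ?t = "\<lambda>a x. a x \<otimes> c (inv\<^bsub>G\<^esub> x \<otimes>\<^bsub>G\<^esub> z) \<otimes> \<alpha> x (inv\<^bsub>G\<^esub> x \<otimes>\<^bsub>G\<^esub> z)"
  have "((a \<oplus>\<^bsub>A\<^esub> b) \<otimes>\<^bsub>A\<^esub> c) z = (\<Oplus>x\<in>carrier G. ?t a x \<oplus> ?t b x)"
    using assms z unfolding coeff_mult[OF A.M.a_closed[OF assms(1,2)] assms(3) z]
    by (intro K.finsum_cong') (auto simp: K.l_distr)
  also have "\<dots> = (\<Oplus>x\<in>carrier G. ?t a x) \<oplus> (\<Oplus>x\<in>carrier G. ?t b x)"
    using assms z by (intro K.finsum_addf) auto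
  finally show "((a \<oplus>\<^bsub>A\<^esub> b) \<otimes>\<^bsub>A\<^esub> c) z = (a \<otimes>\<^bsub>A\<^esub> c \<oplus>\<^bsub>A\<^esub> b \<otimes>\<^bsub>A\<^esub> c) z"
    using assms z by (simp add: coeff_mult)
qed (use assms in \<open>simp_all add: mult_closed\<close>)

lemma mult_smult_left:
  assumes "k \<in> carrier K" "a \<in> carrier A" "b \<in> carrier A"
  shows "(k \<odot>\<^bsub>A\<^esub> a) \<otimes>\<^bsub>A\<^esub> b = k \<odot>\<^bsub>A\<^esub> (a \<otimes>\<^bsub>A\<^esub> b)"
proof (rule A_eqI)
  fix z
  assume z: "z \<in> carrier G"
  let ?t = "\<lambda>x. a x \<otimes> b (inv\<^bsub>G\<^esub> x \<otimes>\<^bsub>G\<^esub> z) \<otimes> \<alpha> x (inv\<^bsub>G\<^esub> x \<otimes>\<^bsub>G\<^esub> z)"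
  have "((k \<odot>\<^bsub>A\<^esub> a) \<otimes>\<^bsub>A\<^esub> b) z = (\<Oplus>x\<in>carrier G. k \<otimes> ?t x)"
    using assms z unfolding coeff_mult[OF A.smult_closed[OF assms(1,2)] assms(3) z]
    by (intro K.finsum_cong') (auto simp: K.m_assoc)
  also have "\<dots> = k \<otimes> (\<Oplus>x\<in>carrier G. ?t x)"
    using assms z by (intro K.finsum_rdistr[symmetric] finite_G) auto
  finally show "((k \<odot>\<^bsub>A\<^esub> a) \<otimes>\<^bsub>A\<^esub> b) z = (k \<odot>\<^bsub>A\<^esub> (a \<otimes>\<^bsub>A\<^esub> b)) z"
    using assms z by (simp add: coeff_mult)
qed (use assms in \<open>simp_all add: mult_closed\<close>)

lemma basis_mult:
  "g \<in> carrier G \<Longrightarrow> h \<in> carrier G \<Longrightarrow> B g \<otimes>\<^bsub>A\<^esub> B h = \<alpha> g h \<odot>\<^bsub>A\<^esub> B (g \<otimes>\<^bsub>G\<^esub> h)"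
  by (rule twisted_group_ring_basis_mult[OF K.is_cring G.is_group cocycle finite_G])

lemma mult_add_right:
  assumes "a \<in> carrier A" "b \<in> carrier A" "c \<in> carrier A"
  shows "c \<otimes>\<^bsub>A\<^esub> (a \<oplus>\<^bsub>A\<^esub> b) = c \<otimes>\<^bsub>A\<^esub> a \<oplus>\<^bsub>A\<^esub> c \<otimes>\<^bsub>A\<^esub> b"
proof (rule A_eqI)
  fix z
  assume z: "z \<in> carrier G"
  let ?t = "\<lambda>a x. c x \<otimes> a (inv\<^bsub>G\<^esub> x \<otimes>\<^bsub>G\<^esub> z) \<otimes> \<alpha> x (inv\<^bsub>G\<^esub> x \<otimes>\<^bsub>G\<^esub> z)"
  have "(c \<otimes>\<^bsub>A\<^esub> (a \<oplus>\<^bsub>A\<^esub> b)) z = (\<Oplus>x\<in>carrier G. ?t a x \<oplus> ?t b x)"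
    using assms z unfolding coeff_mult[OF assms(3) A.M.a_closed[OF assms(1,2)] z]
    by (intro K.finsum_cong') (auto simp: K.l_distr K.r_distr)
  also have "\<dots> = (\<Oplus>x\<in>carrier G. ?t a x) \<oplus> (\<Oplus>x\<in>carrier G. ?t b x)"
    using assms z by (intro K.finsum_addf) auto
  finally show "(c \<otimes>\<^bsub>A\<^esub> (a \<oplus>\<^bsub>A\<^esub> b)) z = (c \<otimes>\<^bsub>A\<^esub> a \<oplus>\<^bsub>A\<^esub> c \<otimes>\<^bsub>A\<^esub> b) z"
    using assms z by (simp add: coeff_mult)
qed (use assms in \<open>simp_all add: mult_closed\<close>)

lemma mult_smult_right:
  assumes "k \<in> carrier K" "a \<in> carrier A" "b \<in> carrier A"
  shows "a \<otimes>\<^bsub>A\<^esub> (k \<odot>\<^bsub>A\<^esub> b) = k \<odot>\<^bsub>A\<^esub> (a \<otimes>\<^bsub>A\<^esub> b)"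
proof (rule A_eqI)
  fix z
  assume z: "z \<in> carrier G"
  let ?t = "\<lambda>x. a x \<otimes> b (inv\<^bsub>G\<^esub> x \<otimes>\<^bsub>G\<^esub> z) \<otimes> \<alpha> x (inv\<^bsub>G\<^esub> x \<otimes>\<^bsub>G\<^esub> z)"
  have "(a \<otimes>\<^bsub>A\<^esub> (k \<odot>\<^bsub>A\<^esub> b)) z = (\<Oplus>x\<in>carrier G. k \<otimes> ?t x)"
    using assms z unfolding coeff_mult[OF assms(2) A.smult_closed[OF assms(1,3)] z]
    by (intro K.finsum_cong') (auto simp: K.m_ac)
  also have "\<dots> = k \<otimes> (\<Oplus>x\<in>carrier G. ?t x)"
    using assms z by (intro K.finsum_rdistr[symmetric] finite_G) auto
  finally show "(a \<otimes>\<^bsub>A\<^esub> (k \<odot>\<^bsub>A\<^esub> b)) z = (k \<odot>\<^bsub>A\<^esub> (a \<otimes>\<^bsub>A\<^esub> b)) z"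
    using assms z by (simp add: coeff_mult)
qed (use assms in \<open>simp_all add: mult_closed\<close>)

lemmas bilinear = mult_closed mult_add_left mult_add_right mult_smult_left mult_smult_right

lemma mult_zero:
  assumes "a \<in> carrier A"
  shows "\<zero>\<^bsub>A\<^esub> \<otimes>\<^bsub>A\<^esub> a = \<zero>\<^bsub>A\<^esub>" and "a \<otimes>\<^bsub>A\<^esub> \<zero>\<^bsub>A\<^esub> = \<zero>\<^bsub>A\<^esub>"
  using mult_smult_left[of \<zero> "\<zero>\<^bsub>A\<^esub>" a] mult_smult_right[of \<zero> a "\<zero>\<^bsub>A\<^esub>"] assms
  by (simp_all add: mult_closed)

lemma mult_commute:
  assumes a: "a \<in> carrier A" and b: "b \<in> carrier A"
  shows "a \<otimes>\<^bsub>A\<^esub> b = b \<otimes>\<^bsub>A\<^esub> a"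
proof -
  have basis: "B g \<otimes>\<^bsub>A\<^esub> b = b \<otimes>\<^bsub>A\<^esub> B g" if g: "g \<in> carrier G" for g
    using b
  proof (induction b rule: basis_induct)
    case (step b c h)
    have "B g \<otimes>\<^bsub>A\<^esub> B h = B h \<otimes>\<^bsub>A\<^esub> B g"
      using g step by (simp add: basis_mult symmetric[of g h] G.m_comm[of g h])
    with step show ?case
      by (simp add: bilinear)
  qed (simp add: mult_zero)
  from a show ?thesis
  proof (induction a rule: basis_induct)
    case (step a c g)
    then show ?case
      using b by (simp add: bilinear basis)
  qed (use b in \<open>simp add: mult_zero\<close>)
qed

lemma mult_assoc:
  assumes a: "a \<in> carrier A" and b: "b \<in> carrier A" and c: "c \<in> carrier A"
  shows "a \<otimes>\<^bsub>A\<^esub> b \<otimes>\<^bsub>A\<^esub> c = a \<otimes>\<^bsub>A\<^esub> (b \<otimes>\<^bsub>A\<^esub> c)"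
proof -
  have 1: "B g \<otimes>\<^bsub>A\<^esub> B h \<otimes>\<^bsub>A\<^esub> c = B g \<otimes>\<^bsub>A\<^esub> (B h \<otimes>\<^bsub>A\<^esub> c)"
    if g: "g \<in> carrier G" and h: "h \<in> carrier G" for g h
    using c
  proof (induction c rule: basis_induct)
    case (step c k l)
    have "B g \<otimes>\<^bsub>A\<^esub> B h \<otimes>\<^bsub>A\<^esub> B l =
        (\<alpha> g h \<otimes> \<alpha> (g \<otimes>\<^bsub>G\<^esub> h) l) \<odot>\<^bsub>A\<^esub> B (g \<otimes>\<^bsub>G\<^esub> (h \<otimes>\<^bsub>G\<^esub> l))"
      using g h step by (simp add: basis_mult bilinear A.smult_assoc1 G.m_assoc)
    also have "\<dots> = B g \<otimes>\<^bsub>A\<^esub> (B h \<otimes>\<^bsub>A\<^esub> B l)"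
      using g h step by (simp add: basis_mult bilinear A.smult_assoc1 cocycle_eq)
    finally show ?case
      using step by (simp add: bilinear)
  qed (simp add: mult_zero bilinear)
  have 2: "B g \<otimes>\<^bsub>A\<^esub> b \<otimes>\<^bsub>A\<^esub> c = B g \<otimes>\<^bsub>A\<^esub> (b \<otimes>\<^bsub>A\<^esub> c)" if g: "g \<in> carrier G" for g
    using b
  proof (induction b rule: basis_induct)
    case (step b k h)
    then show ?case
      using c 1[OF g, of h] by (simp add: bilinear)
  qed (use c in \<open>simp add: mult_zero\<close>)
  from a show ?thesis
  proof (induction a rule: basis_induct)
    case (step a k g)
    then show ?case
      using b c 2[of g] by (simp add: bilinear)
  qed (use b c in \<open>simp add: mult_zero bilinear\<close>)
qed

lemma mult_one:
  assumes "a \<in> carrier A"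
  shows "\<one>\<^bsub>A\<^esub> \<otimes>\<^bsub>A\<^esub> a = a"
  using assms
proof (induction a rule: basis_induct)
  case (step a c g)
  then show ?case
    by (simp add: bilinear A_one basis_mult)
qed (simp add: A_one mult_zero)

lemma A_algebra: "algebra K A"
proof (rule algebraI)
  show "cring A"
  proof (rule cringI)
    show "comm_monoid A"
    proof (rule comm_monoidI)
      show "\<one>\<^bsub>A\<^esub> \<in> carrier A"
        by (simp add: A_one)
    qed (fact mult_closed mult_assoc mult_one mult_commute)+
  qed (simp_all add: A.M.abelian_group_axioms mult_add_left)
qed (simp_all add: K.is_cring A.smult_l_distr A.smult_r_distr A.smult_assoc1 mult_smult_left)

sublocale A: algebra K A
  by (rule A_algebra)

lemma basis_Units:
  assumes g: "g \<in> carrier G"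
  shows "B g \<in> Units A"
proof -
  let ?c = "\<alpha> g (inv\<^bsub>G\<^esub> g)"
  let ?b = "inv ?c \<odot>\<^bsub>A\<^esub> B (inv\<^bsub>G\<^esub> g)"
  have c: "?c \<in> Units K"
    using g by (simp add: cocycle_Units)
  have "B g \<otimes>\<^bsub>A\<^esub> ?b = inv ?c \<odot>\<^bsub>A\<^esub> (?c \<odot>\<^bsub>A\<^esub> \<one>\<^bsub>A\<^esub>)"
    using g c by (simp add: mult_smult_right basis_mult A_one)
  also have "\<dots> = \<one>\<^bsub>A\<^esub>"
    using c g A.smult_assoc1[of "inv ?c" ?c "\<one>\<^bsub>A\<^esub>"] by (simp add: A_one)
  finally have "B g \<otimes>\<^bsub>A\<^esub> ?b = \<one>\<^bsub>A\<^esub>" .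
  moreover have "?b \<in> carrier A"
    using c by simp
  ultimately show ?thesis
    using mult_commute[of "B g" ?b] unfolding Units_def by auto
qed

lemma basis_pow:
  fixes n :: nat
  assumes g: "g \<in> carrier G"
  shows "\<exists>c\<in>carrier K. B g [^]\<^bsub>A\<^esub> n = c \<odot>\<^bsub>A\<^esub> B (g [^]\<^bsub>G\<^esub> n)"
proof (induction n)
  case 0
  show ?case
    by (rule bexI[of _ \<one>]) (simp_all add: A_one)
next
  case (Suc n)
  then obtain c where c: "c \<in> carrier K" "B g [^]\<^bsub>A\<^esub> n = c \<odot>\<^bsub>A\<^esub> B (g [^]\<^bsub>G\<^esub> n)"
    by blast
  have "B g [^]\<^bsub>A\<^esub> Suc n = (c \<otimes> \<alpha> (g [^]\<^bsub>G\<^esub> n) g) \<odot>\<^bsub>A\<^esub> B (g [^]\<^bsub>G\<^esub> Suc n)"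
    using c g by (simp add: mult_smult_left basis_mult A.smult_assoc1)
  then show ?case
    using c g by (intro bexI[of _ "c \<otimes> \<alpha> (g [^]\<^bsub>G\<^esub> n) g"]) auto
qed

text \<open>The Leibniz rule holds term by term: a product of the coefficients at \<open>x\<close> and \<open>y\<close> contributes at
  \<open>x y\<close>, and \<open>\<theta> (x y) = \<theta> x + \<theta> y\<close>.\<close>

lemma euler_derivation:
  assumes \<theta>: "\<theta> \<in> hom G (add_monoid K)"
  shows "(\<lambda>a\<in>carrier A. \<lambda>g\<in>carrier G. \<theta> g \<otimes> a g) \<in> derivations A"
    (is "?E \<in> _")
proof (rule derivationsI)
  have \<theta>_closed [simp]: "\<theta> g \<in> carrier K" if "g \<in> carrier G" for g
    using hom_in_carrier[OF \<theta> that] by simp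
  show E: "?E \<in> carrier A \<rightarrow>\<^sub>E carrier A"
    by (auto simp: A_carrier)
  have E_closed [simp]: "?E a \<in> carrier A" if "a \<in> carrier A" for a
    using E that by blast
  have E_coeff [simp]: "?E a g = \<theta> g \<otimes> a g" if "a \<in> carrier A" "g \<in> carrier G" for a g
    using that by simp
  fix a b
  assume a: "a \<in> carrier A" and b: "b \<in> carrier A"
  show "?E (a \<oplus>\<^bsub>A\<^esub> b) = ?E a \<oplus>\<^bsub>A\<^esub> ?E b"
    using a b by (intro A_eqI) (simp_all add: K.r_distr del: restrict_apply)
  show "?E (a \<otimes>\<^bsub>A\<^esub> b) = ?E a \<otimes>\<^bsub>A\<^esub> b \<oplus>\<^bsub>A\<^esub> a \<otimes>\<^bsub>A\<^esub> ?E b"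
  proof (rule A_eqI)
    fix z
    assume z: "z \<in> carrier G"
    let ?y = "\<lambda>x. inv\<^bsub>G\<^esub> x \<otimes>\<^bsub>G\<^esub> z"
    let ?t = "\<lambda>x. a x \<otimes> b (?y x) \<otimes> \<alpha> x (?y x)"
    \<comment> \<open>additivity of \<open>\<theta>\<close> on the factorisation \<open>z = x (inv x z)\<close>\<close>
    have \<theta>_split: "\<theta> z = \<theta> x \<oplus> \<theta> (?y x)" if "x \<in> carrier G" for x
    proof -
      have "z = x \<otimes>\<^bsub>G\<^esub> ?y x"
        using that z by (simp flip: G.m_assoc)
      then show ?thesis
        using hom_mult[OF \<theta> that, of "?y x"] that z by simp
    qed
    have "?E (a \<otimes>\<^bsub>A\<^esub> b) z = (\<Oplus>x\<in>carrier G. \<theta> z \<otimes> ?t x)"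
      using a b z by (simp add: coeff_mult mult_closed K.finsum_rdistr finite_G del: restrict_apply)
    also have "\<dots> = (\<Oplus>x\<in>carrier G. ?E a x \<otimes> b (?y x) \<otimes> \<alpha> x (?y x) \<oplus>
        a x \<otimes> ?E b (?y x) \<otimes> \<alpha> x (?y x))"
    proof (rule K.finsum_cong')
      fix x
      assume x: "x \<in> carrier G"
      show "\<theta> z \<otimes> ?t x = ?E a x \<otimes> b (?y x) \<otimes> \<alpha> x (?y x) \<oplus> a x \<otimes> ?E b (?y x) \<otimes> \<alpha> x (?y x)"
        unfolding \<theta>_split[OF x] using a b x z
        by (simp add: K.l_distr K.r_distr K.m_ac del: restrict_apply)
    qed (use a b z in \<open>simp_all del: restrict_apply\<close>)
    also have "\<dots> = (?E a \<otimes>\<^bsub>A\<^esub> b \<oplus>\<^bsub>A\<^esub> a \<otimes>\<^bsub>A\<^esub> ?E b) z"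
      using a b z by (simp add: coeff_mult K.finsum_addf Pi_def del: restrict_apply)
    finally show "?E (a \<otimes>\<^bsub>A\<^esub> b) z = (?E a \<otimes>\<^bsub>A\<^esub> b \<oplus>\<^bsub>A\<^esub> a \<otimes>\<^bsub>A\<^esub> ?E b) z" .
  qed (use a b in \<open>simp_all add: mult_closed del: restrict_apply\<close>)
qed

end

section \<open>Derivations of a twisted group algebra\<close>

context symmetric_twisted_group_ring
begin

text \<open>Closure under products and inverses uses that \<open>d\<close> is linear over the finite field \<open>K\<close>: the
  elements \<open>B (g h)\<close> and \<open>B g \<cdot> B h\<close> differ by a scalar.\<close>

lemma derivation_kernel_subgroup:
  assumes K: "finite (carrier K)" and d: "d \<in> derivations A"
  shows "subgroup {g \<in> carrier G. d (B g) = \<zero>\<^bsub>A\<^esub>} G"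
proof
  note d_smult = derivation_smult[OF A_algebra K.field_axioms K d]
  note d_closed = derivation_closed[OF d]
  have d_one: "d \<one>\<^bsub>A\<^esub> = \<zero>\<^bsub>A\<^esub>"
    by (rule A.derivation_one[OF d])
  then show "\<one>\<^bsub>G\<^esub> \<in> {g \<in> carrier G. d (B g) = \<zero>\<^bsub>A\<^esub>}"
    by (simp add: A_one)
  fix g h
  assume g: "g \<in> {g \<in> carrier G. d (B g) = \<zero>\<^bsub>A\<^esub>}"
  {
    assume h: "h \<in> {g \<in> carrier G. d (B g) = \<zero>\<^bsub>A\<^esub>}"
    have c: "\<alpha> g h \<in> Units K"
      using g h by (simp add: cocycle_Units)
    have "B (g \<otimes>\<^bsub>G\<^esub> h) = inv (\<alpha> g h) \<odot>\<^bsub>A\<^esub> (B g \<otimes>\<^bsub>A\<^esub> B h)"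
      using g h c A.smult_assoc1[of "inv (\<alpha> g h)" "\<alpha> g h" "B (g \<otimes>\<^bsub>G\<^esub> h)"]
      by (simp add: basis_mult)
    then show "g \<otimes>\<^bsub>G\<^esub> h \<in> {g \<in> carrier G. d (B g) = \<zero>\<^bsub>A\<^esub>}"
      using g h c by (simp add: d_smult derivation_mult[OF d])
  }
  have g': "g \<in> carrier G" "inv\<^bsub>G\<^esub> g \<in> carrier G"
    using g by auto
  \<comment> \<open>Leibniz rule for \<open>B g \<cdot> B (inv g)\<close>, a scalar multiple of the identity; \<open>B g\<close> is a unit\<close>
  have "B g \<otimes>\<^bsub>A\<^esub> d (B (inv\<^bsub>G\<^esub> g)) = d (B g \<otimes>\<^bsub>A\<^esub> B (inv\<^bsub>G\<^esub> g))"
    using g by (simp add: derivation_mult[OF d] d_closed)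
  also have "\<dots> = \<zero>\<^bsub>A\<^esub>"
    using g' d_one by (simp add: basis_mult d_smult flip: A_one)
  finally have "B g \<otimes>\<^bsub>A\<^esub> d (B (inv\<^bsub>G\<^esub> g)) = B g \<otimes>\<^bsub>A\<^esub> \<zero>\<^bsub>A\<^esub>"
    by (simp add: mult_zero)
  then have "d (B (inv\<^bsub>G\<^esub> g)) = \<zero>\<^bsub>A\<^esub>"
    using A.Units_l_cancel[OF basis_Units[OF g'(1)], of "d (B (inv\<^bsub>G\<^esub> g))" "\<zero>\<^bsub>A\<^esub>"] d_closed
    by simp
  then show "inv\<^bsub>G\<^esub> g \<in> {g \<in> carrier G. d (B g) = \<zero>\<^bsub>A\<^esub>}"
    using g by simp
qed auto

text \<open>The power of \<open>B g\<close> whose exponent is the order of \<open>g\<close> is a scalar.\<close>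

lemma derivation_p_regular:
  assumes K: "finite (carrier K)" and d: "d \<in> derivations A"
    and g: "g \<in> carrier G" "\<not> ring_characteristic K dvd G.ord g"
  shows "d (B g) = \<zero>\<^bsub>A\<^esub>"
proof -
  obtain c where "c \<in> carrier K" "B g [^]\<^bsub>A\<^esub> G.ord g = c \<odot>\<^bsub>A\<^esub> B (g [^]\<^bsub>G\<^esub> G.ord g)"
    using basis_pow[OF g(1)] by blast
  then show ?thesis
    using g A_one
    by (intro derivation_unit_root_of_scalar[OF A_algebra K.field_axioms K d basis_Units]) auto
qed

text \<open>For \<open>y = x\<^sub>i\<close> and \<open>\<theta>\<close> the exponent of \<open>x\<^sub>i\<close> modulo \<open>p\<close> this is the partial derivative
  \<open>\<partial>/\<partial>x\<^sub>i = x\<^sub>i\<^sup>-\<^sup>1 (x\<^sub>i \<partial>/\<partial>x\<^sub>i)\<close>.\<close>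

lemma scaled_euler_derivation:
  assumes \<theta>: "\<theta> \<in> hom G (add_monoid K)" and y: "y \<in> carrier G"
  obtains d where "d \<in> derivations A"
    and "\<And>g. g \<in> carrier G \<Longrightarrow> d (B g) = \<theta> g \<odot>\<^bsub>A\<^esub> (inv\<^bsub>A\<^esub> (B y) \<otimes>\<^bsub>A\<^esub> B g)"
proof
  let ?E = "\<lambda>a\<in>carrier A. \<lambda>g\<in>carrier G. \<theta> g \<otimes> a g"
  have inv: "inv\<^bsub>A\<^esub> (B y) \<in> carrier A"
    using y by (simp add: basis_Units)
  show "left_mult A (inv\<^bsub>A\<^esub> (B y)) ?E \<in> derivations A"
    by (rule A.left_mult_derivation[OF euler_derivation[OF \<theta>] inv])
  fix g
  assume g: "g \<in> carrier G"
  have \<theta>g: "\<theta> g \<in> carrier K"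
    using hom_in_carrier[OF \<theta> g] by simp
  have "?E (B g) = \<theta> g \<odot>\<^bsub>A\<^esub> B g"
    using derivation_closed[OF euler_derivation[OF \<theta>], of "B g"] \<theta>g hom_in_carrier[OF \<theta>]
    by (intro A_eqI) auto
  then show "left_mult A (inv\<^bsub>A\<^esub> (B y)) ?E (B g) = \<theta> g \<odot>\<^bsub>A\<^esub> (inv\<^bsub>A\<^esub> (B y) \<otimes>\<^bsub>A\<^esub> B g)"
    using inv \<theta>g by (simp add: left_mult_def mult_smult_right)
qed

end

text \<open>What the direct decomposition \<open>G = H X\<close> and the presentation of \<open>X\<close> contribute: \<open>\<theta> i g\<close> is the
  exponent of \<open>x i\<close> in \<open>g\<close>, as an element of \<open>K\<close>, and \<open>generated\<close> says that the \<open>x i\<close> together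
  with the elements of order prime to the characteristic generate \<open>G\<close>.\<close>

locale coordinate_twisted_group_ring = symmetric_twisted_group_ring K G \<alpha>
  for K :: "('k, 'r) ring_scheme" (structure) and G :: "('g, 's) monoid_scheme"
    and \<alpha> :: "'g \<Rightarrow> 'g \<Rightarrow> 'k" +
  fixes n :: nat and x :: "nat \<Rightarrow> 'g" and \<theta> :: "nat \<Rightarrow> 'g \<Rightarrow> 'k"
  assumes finite_K: "finite (carrier K)"
    and x_closed: "i \<in> {1..n} \<Longrightarrow> x i \<in> carrier G"
    and \<theta>_hom: "i \<in> {1..n} \<Longrightarrow> \<theta> i \<in> hom G (add_monoid K)"
    and \<theta>_dual: "i \<in> {1..n} \<Longrightarrow> j \<in> {1..n} \<Longrightarrow> \<theta> i (x j) = (if i = j then \<one> else \<zero>)"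
    and generated: "subgroup Z G \<Longrightarrow> x ` {1..n} \<subseteq> Z \<Longrightarrow>
      {g \<in> carrier G. \<not> ring_characteristic K dvd G.ord g} \<subseteq> Z \<Longrightarrow> Z = carrier G"
begin

lemma derivation_eq_zero:
  assumes d: "d \<in> derivations A" and x: "\<And>i. i \<in> {1..n} \<Longrightarrow> d (B (x i)) = \<zero>\<^bsub>A\<^esub>"
    and a: "a \<in> carrier A"
  shows "d a = \<zero>\<^bsub>A\<^esub>"
proof -
  have "{g \<in> carrier G. d (B g) = \<zero>\<^bsub>A\<^esub>} = carrier G"
    using x x_closed derivation_p_regular[OF finite_K d]
    by (intro generated derivation_kernel_subgroup[OF finite_K d]) auto
  then have basis: "d (B g) = \<zero>\<^bsub>A\<^esub>" if "g \<in> carrier G" for g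
    using that by blast
  from a show ?thesis
  proof (induction a rule: basis_induct)
    case zero
    show ?case
      by (rule A.derivation_zero[OF d])
  next
    case (step a c g)
    then show ?case
      by (simp add: derivation_add[OF d] basis
          derivation_smult[OF A_algebra K.field_axioms finite_K d])
  qed
qed

abbreviation D where "D \<equiv> derivation_module A"

lemma D_vectorspace: "vectorspace K D"
  by (intro vectorspace.intro module_derivations A_algebra K.field_axioms)

sublocale D: vectorspace K D
  by (rule D_vectorspace)

lemma D_carrier: "carrier D = derivations A"
  and D_add: "a \<in> carrier A \<Longrightarrow> (d \<oplus>\<^bsub>D\<^esub> e) a = d a \<oplus>\<^bsub>A\<^esub> e a"
  and D_smult: "a \<in> carrier A \<Longrightarrow> (c \<odot>\<^bsub>D\<^esub> d) a = c \<odot>\<^bsub>A\<^esub> d a"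
  and D_zero: "a \<in> carrier A \<Longrightarrow> \<zero>\<^bsub>D\<^esub> a = \<zero>\<^bsub>A\<^esub>"
  by (simp_all add: derivation_module_def)

text \<open>The difference of the two derivations is a derivation that vanishes on all \<open>B (x i)\<close>.\<close>

lemma derivation_determined:
  assumes d: "d \<in> derivations A" and e: "e \<in> derivations A"
    and eq: "\<And>i. i \<in> {1..n} \<Longrightarrow> d (B (x i)) = e (B (x i))"
  shows "d = e"
proof (rule derivation_eqI[OF d e])
  fix a
  assume a: "a \<in> carrier A"
  let ?f = "d \<oplus>\<^bsub>D\<^esub> (\<ominus> \<one>) \<odot>\<^bsub>D\<^esub> e"
  have f: "?f \<in> derivations A"
    using D.M.a_closed[of d "(\<ominus> \<one>) \<odot>\<^bsub>D\<^esub> e"] D.smult_closed[of "\<ominus> \<one>" e] d e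
    unfolding D_carrier by simp
  have f_apply: "?f b = d b \<ominus>\<^bsub>A\<^esub> e b" if "b \<in> carrier A" for b
    using that derivation_closed[OF e that]
    by (simp add: D_add D_smult A.smult_l_minus a_minus_def)
  have "d a \<ominus>\<^bsub>A\<^esub> e a = \<zero>\<^bsub>A\<^esub>"
    unfolding f_apply[OF a, symmetric]
    by (rule derivation_eq_zero[OF f _ a])
      (simp add: f_apply eq derivation_closed[OF e] A.M.r_neg a_minus_def)
  then show "d a = e a"
    using a derivation_closed[OF d a] derivation_closed[OF e a] by simp
qed

lemma ex1_partial_derivation:
  assumes i: "i \<in> {1..n}"
  shows "\<exists>!d. d \<in> derivations A \<and> extends_coordinate K G \<alpha> n x i d"
proof -
  obtain d where d: "d \<in> derivations A"
    and dB: "\<And>g. g \<in> carrier G \<Longrightarrow> d (B g) = \<theta> i g \<odot>\<^bsub>A\<^esub> (inv\<^bsub>A\<^esub> (B (x i)) \<otimes>\<^bsub>A\<^esub> B g)"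
    using scaled_euler_derivation[OF \<theta>_hom[OF i] x_closed[OF i]] by blast
  have "extends_coordinate K G \<alpha> n x i d"
    using i x_closed basis_Units
    by (auto simp: extends_coordinate_def dB \<theta>_dual)
  moreover have "e = d"
    if "e \<in> derivations A" "extends_coordinate K G \<alpha> n x i e" for e
    using that calculation by (intro derivation_determined d) (auto simp: extends_coordinate_def)
  ultimately show ?thesis
    using d by blast
qed

abbreviation \<delta> where "\<delta> \<equiv> partial_derivation K G \<alpha> n x"

lemma partial_derivation:
  assumes i: "i \<in> {1..n}"
  shows "\<delta> i \<in> derivations A"
    and "j \<in> {1..n} \<Longrightarrow> \<delta> i (B (x j)) = (if i = j then \<one>\<^bsub>A\<^esub> else \<zero>\<^bsub>A\<^esub>)"
  using theI'[OF ex1_partial_derivation[OF i], folded partial_derivation_def]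
  unfolding extends_coordinate_def by auto

text \<open>The functional dual to \<open>B g \<cdot> \<delta> i\<close> takes the coefficient of \<open>B g\<close> in the value at \<open>B (x i)\<close>;
  these functionals separate derivations by \<open>derivation_determined\<close>.\<close>

lemma basis_derivations:
  defines "v \<equiv> \<lambda>(g, i). left_mult A (B g) (\<delta> i)"
  shows "inj_on v (carrier G \<times> {1..n})" and "D.basis (v ` (carrier G \<times> {1..n}))"
proof -
  define \<phi> :: "'g \<times> nat \<Rightarrow> (('g \<Rightarrow> 'k) \<Rightarrow> 'g \<Rightarrow> 'k) \<Rightarrow> 'k"
    where "\<phi> = (\<lambda>(g, i) d. d (B (x i)) g)"
  let ?I = "carrier G \<times> {1..n}"
  note [simp] = derivation_closed
  have 1: "finite ?I"
    using finite_G by simp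
  have 2: "v j \<in> carrier D" if "j \<in> ?I" for j
    using that by (auto simp: v_def D_carrier intro!: A.left_mult_derivation partial_derivation)
  have 3: "\<phi> j d \<in> carrier K" if "j \<in> ?I" "d \<in> carrier D" for j d
    using that by (auto simp: \<phi>_def D_carrier)
  have 4: "\<phi> j (d \<oplus>\<^bsub>D\<^esub> e) = \<phi> j d \<oplus> \<phi> j e" if "j \<in> ?I" for j d e
    using that by (auto simp: \<phi>_def D_add)
  have 5: "\<phi> j (c \<odot>\<^bsub>D\<^esub> d) = c \<otimes> \<phi> j d" if "j \<in> ?I" for j c d
    using that by (auto simp: \<phi>_def D_smult)
  have 6: "\<phi> j (v k) = (if j = k then \<one> else \<zero>)" if "j \<in> ?I" "k \<in> ?I" for j k
    using that
    by (cases "snd j = snd k")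
      (auto simp: \<phi>_def v_def left_mult_def partial_derivation mult_zero
        split: if_splits)
  have 7: "d = \<zero>\<^bsub>D\<^esub>" if d: "d \<in> carrier D" and zero: "\<And>j. j \<in> ?I \<Longrightarrow> \<phi> j d = \<zero>" for d
  proof -
    have "d (B (x i)) = \<zero>\<^bsub>A\<^esub>" if "i \<in> {1..n}" for i
      using zero[of "(_, i)"] that d by (intro A_eqI) (auto simp: \<phi>_def D_carrier)
    then show ?thesis
      using d D.M.zero_closed unfolding D_carrier
      by (intro derivation_determined) (auto simp: D_zero)
  qed
  show "inj_on v ?I" "D.basis (v ` ?I)"
    using D.dual_family_basis[of ?I v \<phi>, OF 1 2 3 4 5 6 7] by blast+
qed

end

section \<open>Subgroups, direct factors and the presentation\<close>

lemma eval_word_in_subgroup: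
  assumes "group G" "subgroup X G" "subgroup Z G" "\<And>k. k \<in> I \<Longrightarrow> x k \<in> X \<inter> Z"
    and "w \<in> lists (I \<times> UNIV)"
  shows "eval_word (G\<lparr>carrier := X\<rparr>) x w \<in> Z"
proof -
  interpret G: group G by fact
  interpret Z: subgroup Z G by fact
  from assms(5) show ?thesis
  proof (induction w)
    case (Cons a w)
    then have "x (fst a) \<in> X" "x (fst a) \<in> Z"
      using assms(4) by auto
    with Cons show ?case
      by (cases a) (simp add: G.m_inv_consistent[OF assms(2)])
  qed simp
qed

text \<open>The extension is the composition of \<open>\<phi>\<close> with the projection of \<open>G\<close> onto \<open>X\<close> along \<open>H\<close>.\<close>

lemma direct_factor_hom:
  assumes G: "group G" and H: "subgroup H G" and X: "subgroup X G"
    and iso: "(\<lambda>(h, y). h \<otimes>\<^bsub>G\<^esub> y) \<in> iso (G\<lparr>carrier := H\<rparr> \<times>\<times> G\<lparr>carrier := X\<rparr>) G"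
    and \<phi>: "\<phi> \<in> hom (G\<lparr>carrier := X\<rparr>) L"
  obtains \<psi> where "\<psi> \<in> hom G L" "\<And>y. y \<in> X \<Longrightarrow> \<psi> y = \<phi> y"
proof
  interpret G: group G by fact
  let ?P = "G\<lparr>carrier := H\<rparr> \<times>\<times> G\<lparr>carrier := X\<rparr>"
  let ?m = "\<lambda>(h, y). h \<otimes>\<^bsub>G\<^esub> y"
  let ?j = "inv_into (carrier ?P) ?m"
  interpret P: group ?P
    by (intro DirProd_group G.subgroup_imp_group H X)
  have j: "?j \<in> hom G ?P"
    using P.iso_set_sym[OF iso] by (simp add: iso_def)
  have snd: "snd \<in> hom ?P (G\<lparr>carrier := X\<rparr>)"
    by (auto intro!: homI)
  show "\<phi> \<circ> (snd \<circ> ?j) \<in> hom G L"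
    by (rule hom_compose[OF hom_compose[OF j snd] \<phi>])
  fix y
  assume y: "y \<in> X"
  have "inj_on ?m (carrier ?P)"
    using iso by (simp add: iso_def bij_betw_def)
  moreover have "(\<one>\<^bsub>G\<^esub>, y) \<in> carrier ?P"
    using y by (simp add: subgroup.one_closed[OF H])
  ultimately have "?j (?m (\<one>\<^bsub>G\<^esub>, y)) = (\<one>\<^bsub>G\<^esub>, y)"
    by (rule inv_into_f_f)
  then show "(\<phi> \<circ> (snd \<circ> ?j)) y = \<phi> y"
    using subgroup.mem_carrier[OF X y] by simp
qed

theorem mainTheorem2:
  fixes K :: "'k ring" and G :: "'g monoid" and H X :: "'g set"
    and p n :: nat and m :: "nat \<Rightarrow> nat" and x :: "nat \<Rightarrow> 'g" and \<alpha> :: "'g \<Rightarrow> 'g \<Rightarrow> 'k"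
  assumes "field K" and "finite (carrier K)"
    and "ring_characteristic K = p" and "p > 0"
    and "comm_group G" and "finite (carrier G)"
    and "subgroup H G" and "subgroup X G"
    and "(\<lambda>(h, y). h \<otimes>\<^bsub>G\<^esub> y) \<in> iso (G\<lparr>carrier := H\<rparr> \<times>\<times> G\<lparr>carrier := X\<rparr>) G"
    and "p_regular p (G\<lparr>carrier := H\<rparr>)"
    and "p_group p (G\<lparr>carrier := X\<rparr>)"
    and "n \<ge> 1" and "\<forall>k\<in>{1..n}. m k \<ge> 1"
    and "has_presentation (G\<lparr>carrier := X\<rparr>) {1..n} x
           ({power_relator k (p ^ m k) |k. k \<in> {1..n}} \<union>
            {commutator_relator k l |k l. k \<in> {1..n} \<and> l \<in> {1..n}})"
    and "two_cocycle K G \<alpha>" and "normalized_cocycle K G \<alpha>"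
    and "H \<subseteq> alpha_center G \<alpha>"
  shows "(\<forall>i\<in>{1..n}. \<exists>!d. d \<in> derivations (twisted_group_ring K G \<alpha>) \<and>
                            extends_coordinate K G \<alpha> n x i d) \<and>
         vectorspace K (derivation_module (twisted_group_ring K G \<alpha>)) \<and>
         inj_on (\<lambda>(g, i). left_mult (twisted_group_ring K G \<alpha>) (basis_elem K G g)
                            (partial_derivation K G \<alpha> n x i)) (carrier G \<times> {1..n}) \<and>
         vectorspace.basis K (derivation_module (twisted_group_ring K G \<alpha>))
           {left_mult (twisted_group_ring K G \<alpha>) (basis_elem K G g)
              (partial_derivation K G \<alpha> n x i) |g i. g \<in> carrier G \<and> i \<in> {1..n}}"
proof -
  interpret K: field K by fact
  interpret G: comm_group G by fact
  let ?Q = "G\<lparr>carrier := X\<rparr>" and ?W = "lists ({1..n} \<times> (UNIV :: bool set))"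
  have x: "x i \<in> X" if "i \<in> {1..n}" for i
    using \<open>has_presentation _ _ _ _\<close> that unfolding has_presentation_def by auto
  have word: "\<exists>w\<in>?W. eval_word ?Q x w = y" if "y \<in> X" for y
    using \<open>has_presentation _ _ _ _\<close> that unfolding has_presentation_def by auto
  have HX: "\<exists>h\<in>H. \<exists>y\<in>X. g = h \<otimes>\<^bsub>G\<^esub> y" if "g \<in> carrier G" for g
  proof -
    have "(\<lambda>(h, y). h \<otimes>\<^bsub>G\<^esub> y) ` (H \<times> X) = carrier G"
      using \<open>_ \<in> iso _ _\<close> by (simp add: iso_def bij_betw_def)
    with that show ?thesis
      by (force simp: image_iff)
  qed
  have ord_sub: "group.ord (G\<lparr>carrier := S\<rparr>) g = G.ord g" if "subgroup S G" "g \<in> S" for S g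
    using that by (simp add: group.ord_def[OF G.subgroup_imp_group] G.ord_def flip: G.nat_pow_consistent)
  have symmetric: "\<alpha> g k = \<alpha> k g" if g: "g \<in> carrier G" and k: "k \<in> carrier G" for g k
  proof -
    obtain h y where h: "h \<in> H" and y: "y \<in> X" and k_eq: "k = h \<otimes>\<^bsub>G\<^esub> y"
      using HX[OF k] by blast
    have hG: "h \<in> carrier G" and yG: "y \<in> carrier G"
      using h y \<open>subgroup H G\<close> \<open>subgroup X G\<close> by (auto dest: subgroup.mem_carrier)
    \<comment> \<open>the pairing is multiplicative, so it can be checked on the factors \<open>h\<close> and \<open>y\<close> of \<open>k\<close>\<close>
    define \<beta> where "\<beta> t = \<alpha> g t \<otimes>\<^bsub>K\<^esub> inv\<^bsub>K\<^esub> (\<alpha> t g)" for t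
    have \<beta>: "\<beta> \<in> hom G (units_of K)"
      using commutator_pairing_hom[OF K.is_cring \<open>comm_group G\<close> \<open>two_cocycle K G \<alpha>\<close> g]
      unfolding \<beta>_def .
    note \<beta>_one = commutator_pairing_eq_one_iff[OF K.is_cring \<open>two_cocycle K G \<alpha>\<close> g,
        folded \<beta>_def]
    have "\<exists>e. group.ord ?Q y = p ^ e"
      using \<open>p_group p _\<close> y unfolding p_group_def by simp
    then obtain e where "G.ord y = p ^ e"
      unfolding ord_sub[OF \<open>subgroup X G\<close> y] ..
    then have "\<beta> y = \<one>\<^bsub>K\<^esub>"
      unfolding \<beta>_one[OF yG] using \<open>ring_characteristic K = p\<close> assms(1,2,5,15) g yG
      by (intro cocycle_symmetric_p_element[where K = K and G = G and k = e]) simp_all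
    moreover have "\<beta> h = \<one>\<^bsub>K\<^esub>"
      unfolding \<beta>_one[OF hG] using \<open>H \<subseteq> _\<close> h g unfolding alpha_center_def by auto
    ultimately have "\<beta> k = \<one>\<^bsub>K\<^esub>"
      using hom_mult[OF \<beta> hG yG] by (simp add: k_eq units_of_mult)
    then show ?thesis
      unfolding \<beta>_one[OF k] .
  qed
  have "\<exists>\<theta>. \<theta> \<in> hom G (add_monoid K) \<and>
      (\<forall>j\<in>{1..n}. \<theta> (x j) = (if i = j then \<one>\<^bsub>K\<^esub> else \<zero>\<^bsub>K\<^esub>))" for i
  proof -
    \<comment> \<open>values on the generators that respect the relators because the characteristic divides \<open>p ^ m k\<close>\<close>
    let ?f = "\<lambda>j. if i = j then \<one>\<^bsub>K\<^esub> else \<zero>\<^bsub>K\<^esub>"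
    have L: "comm_group (add_monoid K)"
      by (rule K.a_comm_group)
    have f: "?f \<in> {1..n} \<rightarrow> carrier (add_monoid K)"
      by simp
    obtain \<phi> where \<phi>: "\<phi> \<in> hom ?Q (add_monoid K)" "\<And>j. j \<in> {1..n} \<Longrightarrow> \<phi> (x j) = ?f j"
    proof (rule presentation_hom_exists[OF \<open>has_presentation _ _ _ _\<close> _ f])
      show "group (add_monoid K)"
        by (rule K.a_group)
    next
      fix r
      assume "r \<in> {power_relator k (p ^ m k) |k. k \<in> {1..n}} \<union>
        {commutator_relator k l |k l. k \<in> {1..n} \<and> l \<in> {1..n}}"
      then consider k where "k \<in> {1..n}" "r = power_relator k (p ^ m k)"
        | k l where "r = commutator_relator k l"
        by blast
      then show "eval_word (add_monoid K) ?f r = \<one>\<^bsub>add_monoid K\<^esub>"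
      proof cases
        case 1
        have "p dvd p ^ m k"
          using bspec[OF \<open>\<forall>k\<in>{1..n}. m k \<ge> 1\<close> 1(1)] by (intro dvd_power) simp
        then have zero: "[(p ^ m k)] \<cdot>\<^bsub>K\<^esub> \<one>\<^bsub>K\<^esub> = \<zero>\<^bsub>K\<^esub>"
          unfolding add_pow_one_eq_zero_iff[OF K.is_ring] \<open>ring_characteristic K = p\<close> .
        have "eval_word (add_monoid K) ?f r = [(p ^ m k)] \<cdot>\<^bsub>K\<^esub> ?f k"
          unfolding 1 add_pow_def by (rule eval_power_relator[OF K.a_group]) simp
        also have "\<dots> = \<zero>\<^bsub>K\<^esub>"
          using zero by simp
        finally show ?thesis
          by simp
      next
        case 2
        show ?thesis
          unfolding 2 by (rule eval_commutator_relator[OF L]) auto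
      qed
    qed blast
    obtain \<psi> where "\<psi> \<in> hom G (add_monoid K)" "\<And>y. y \<in> X \<Longrightarrow> \<psi> y = \<phi> y"
      by (rule direct_factor_hom[OF G.is_group \<open>subgroup H G\<close> \<open>subgroup X G\<close> assms(9) \<phi>(1)]) blast
    with \<phi>(2) x show ?thesis
      by (intro exI[of _ \<psi>]) simp
  qed
  then obtain \<theta> where \<theta>: "\<And>i. \<theta> i \<in> hom G (add_monoid K)"
    "\<And>i j. j \<in> {1..n} \<Longrightarrow> \<theta> i (x j) = (if i = j then \<one>\<^bsub>K\<^esub> else \<zero>\<^bsub>K\<^esub>)"
    by metis
  have generated: "Z = carrier G"
    if Z: "subgroup Z G" and xZ: "x ` {1..n} \<subseteq> Z"
      and reg: "{g \<in> carrier G. \<not> ring_characteristic K dvd G.ord g} \<subseteq> Z" for Z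
  proof
    show "Z \<subseteq> carrier G"
      by (rule subgroup.subset[OF Z])
    show "carrier G \<subseteq> Z"
    proof
      fix g
      assume "g \<in> carrier G"
      then obtain h y where h: "h \<in> H" and y: "y \<in> X" and g: "g = h \<otimes>\<^bsub>G\<^esub> y"
        using HX by blast
      have "\<not> p dvd G.ord h"
        using \<open>p_regular p _\<close> h
        unfolding p_regular_def ord_sub[OF \<open>subgroup H G\<close> h, symmetric] by simp
      then have "h \<in> Z"
        using reg h \<open>ring_characteristic K = p\<close> subgroup.mem_carrier[OF \<open>subgroup H G\<close> h] by auto
      moreover have "y \<in> Z"
      proof -
        obtain w where w: "w \<in> ?W" "eval_word ?Q x w = y"
          using word[OF y] by blast
        show ?thesis
          unfolding w(2)[symmetric] using x xZ
          by (intro eval_word_in_subgroup[OF G.is_group \<open>subgroup X G\<close> Z _ w(1)]) blast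
      qed
      ultimately show "g \<in> Z"
        unfolding g by (rule subgroup.m_closed[OF Z])
    qed
  qed
  interpret coordinate_twisted_group_ring K G \<alpha> n x \<theta>
  proof
    show "x i \<in> carrier G" if "i \<in> {1..n}" for i
      by (rule subgroup.mem_carrier[OF \<open>subgroup X G\<close> x[OF that]])
  qed (use assms symmetric \<theta> generated in simp_all)
  have "{left_mult A (B g) (partial_derivation K G \<alpha> n x i) |g i. g \<in> carrier G \<and> i \<in> {1..n}} =
      (\<lambda>(g, i). left_mult A (B g) (partial_derivation K G \<alpha> n x i)) ` (carrier G \<times> {1..n})"
    by auto blast
  then show ?thesis
    using ex1_partial_derivation D_vectorspace basis_derivations by simp
qed

end
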